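(* Let $w\in L^1([-1,1])$, $w\ge0$, $\int_{-1}^1w\,dx=1$, with $\log(w_0)\in L^1(\rho)$, where $\rho(x)=1/(\pi\sqrt{1-x^2})$ and $w_0(x)=\pi\sqrt{1-x^2}w(x)$. Let $p_n$ be the orthonormal polynomials with respect to $w(x)\,dx$, $f_n=p_n\sqrt{w_0}$, $\Delta_n(M)=\{x\in[-1,1]:|f_n(x)|\ge M\}$ and $F_n(w)=-\int_{-1}^1\log(p_n^2(x)w_0(x))\,p_n^2(x)w(x)\,dx$. Then for every $M>\sqrt2$, $$F_n(w)=\log2-1-\int_{\Delta_n(M)}\log(f_n^2(x))\,f_n^2(x)\,\rho(x)\,dx+o(1),\qquad n\to\infty.$$
   Context: Orthonormal polynomials: $p_n$ has degree $n$, positive leading coefficient, $\int p_np_mw\,dx=\delta_{mn}$. *)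

theory Defs
  imports "HOL-Analysis.Analysis" "HOL-Computational_Algebra.Polynomial"
begin

text \<open>Extended-real valued Lebesgue integral of a real function over a set S
  (w.r.t. Lebesgue-Borel measure): positive part minus negative part.
  All integrands used below have integrable negative part, so this is
  the usual integral, possibly +infinity.\<close>
definition ext_set_integral :: "real set \<Rightarrow> (real \<Rightarrow> real) \<Rightarrow> ereal" where
  "ext_set_integral S f =
     enn2ereal (\<integral>\<^sup>+ x. ennreal (f x * indicator S x) \<partial>lborel)
   - enn2ereal (\<integral>\<^sup>+ x. ennreal (- (f x * indicator S x)) \<partial>lborel)"

definition cheb_rho :: "real \<Rightarrow> real" where
  "cheb_rho x = 1 / (pi * sqrt (1 - x\<^sup>2))"

definition wzero :: "(real \<Rightarrow> real) \<Rightarrow> real \<Rightarrow> real" where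
  "wzero w x = pi * sqrt (1 - x\<^sup>2) * w x"

definition orthonormal_polys :: "(real \<Rightarrow> real) \<Rightarrow> (nat \<Rightarrow> real poly) \<Rightarrow> bool" where
  "orthonormal_polys w p \<longleftrightarrow>
     (\<forall>n. degree (p n) = n \<and> lead_coeff (p n) > 0) \<and>
     (\<forall>m n. (LINT x:{-1..1}|lborel. poly (p n) x * poly (p m) x * w x)
              = (if m = n then 1 else 0))"

definition ffn :: "(real \<Rightarrow> real) \<Rightarrow> real poly \<Rightarrow> real \<Rightarrow> real" where
  "ffn w q x = poly q x * sqrt (wzero w x)"

definition Delta :: "(real \<Rightarrow> real) \<Rightarrow> real poly \<Rightarrow> real \<Rightarrow> real set" where
  "Delta w q M = {x \<in> {-1..1}. \<bar>ffn w q x\<bar> \<ge> M}"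

definition entropyF :: "(real \<Rightarrow> real) \<Rightarrow> real poly \<Rightarrow> ereal" where
  "entropyF w q = - ext_set_integral {-1..1}
      (\<lambda>x. ln ((poly q x)\<^sup>2 * wzero w x) * (poly q x)\<^sup>2 * w x)"

end

theory Submission
  imports Defs "HOL-Computational_Algebra.Fundamental_Theorem_Algebra"
begin

text \<open>
  Work in \<open>L\<^sup>2\<close> of the Chebyshev distribution \<open>\<rho>(x) dx\<close>, with \<open>z = e\<^bsup>i\<theta>\<^esup>\<close>, \<open>x = cos \<theta>\<close>, so that the
  powers of \<open>z\<close> are orthonormal for the real inner product. Among the functions
  \<open>h(z) \<surd>w\<^sub>0\<close>, where \<open>h\<close> is a real polynomial with \<open>h(0) = 1\<close>, the infimum \<open>m\<close> of the squared norms is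
  positive, by Jensen's inequality \<open>\<integral> log |h| \<ge> log |h(0)|\<close> and the integrability of \<open>log w\<^sub>0\<close>.
  The minimiser \<open>u\<close> in the closure is orthogonal to \<open>z\<^sup>j u\<close> for all \<open>j \<ge> 1\<close>, hence
  \<open>|u|\<^sup>2 = m\<close> almost everywhere, and \<open>U = u / \<surd>m\<close> is unimodular (the phase of the Szego function, whose
  boundary theory is not needed).

  As \<open>z\<^sup>n p\<^sub>n\<close> is a multiple of a competitor \<open>h(z)\<close>, the inner product of \<open>f\<^sub>n = p\<^sub>n \<surd>w\<^sub>0\<close> with
  \<open>Y\<^sub>n = \<surd>2 Re (z\<^bsup>-n\<^esup> U)\<close> is explicit in terms of the leading coefficient of \<open>p\<^sub>n\<close>; the extremality of
  \<open>p\<^sub>n\<close> among polynomials with given leading coefficient, tested on \<open>2 Re (z\<^bsup>-n\<^esup> h(z))\<close>, bounds it from below,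
  and \<open>\<parallel>f\<^sub>n - Y\<^sub>n\<parallel> \<rightarrow> 0\<close> follows. By Riemann-Lebesgue \<open>Y\<^sub>n\<close> converges in distribution to \<open>\<surd>2 cos \<theta>\<close>, so the part
  of the entropy integral outside \<open>\<Delta>\<^sub>n(M)\<close> tends to \<open>E[2 x\<^sup>2 log (2 x\<^sup>2)] = 1 - log 2\<close>.
\<close>

subsection \<open>Square-integrable functions\<close>

text \<open>Since t^2 log t^2 grows faster than t^2, mean-square convergence of f_n gives no control
  over the entropy integral where f_n is large, and that part may even be infinite. It is therefore
  carried along untouched as the integral over \<open>Delta\<close>, in the extended reals. The
  threshold sqrt 2 is the uniform bound of |Y_n|: for M above it, truncation at M is invisible in
  the limit.

  The expansion of the squared norm of f_n - Y_n is 1 - 2 d_n + |Y_n|^2, where d_n is the inner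
  product of f_n and Y_n and |Y_n|^2 tends to 1. Hence a lower bound d_n >= 1 - o(1) is enough. Let
  c_n be the leading coefficient of p_n divided by 2^n. On the circle z^n p_n(Re z) is a polynomial
  in z with value c_n at 0, which gives d_n = c_n sqrt(2m) exactly. The test polynomial 2 Re(z^-n h)
  has leading coefficient 2^n, which gives 1/c_n <= sqrt(2m) + o(1).

  The obstacle is that u is only a limit of admissible functions, along polynomials h_k of
  uncontrolled degree, while the test requires degree h_k < n. So k is fixed by the wanted accuracy
  before n grows.\<close>

definition sqint :: "'a measure \<Rightarrow> ('a \<Rightarrow> 'b::euclidean_space) \<Rightarrow> bool" where
  "sqint M f \<longleftrightarrow> f \<in> borel_measurable M \<and> integrable M (\<lambda>x. (norm (f x))\<^sup>2)"

text \<open>For complex values the integrand is Re (f cnj g), so this is a real scalar product and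
  only real scalars can be pulled out. Multiplication by powers of z is handled through
  \<open>sqint_mult_bounded\<close> instead.\<close>

definition ip :: "'a measure \<Rightarrow> ('a \<Rightarrow> 'b::euclidean_space) \<Rightarrow> ('a \<Rightarrow> 'b) \<Rightarrow> real" where
  "ip M f g = (\<integral>x. f x \<bullet> g x \<partial>M)"

lemma sqint_measurable: "sqint M f \<Longrightarrow> f \<in> borel_measurable M"
  by (simp add: sqint_def)

lemma abs_inner_le_sum_squares:
  fixes a b :: "'b::real_inner"
  shows "\<bar>a \<bullet> b\<bar> \<le> (norm a)\<^sup>2 + (norm b)\<^sup>2"
proof -
  have "\<bar>a \<bullet> b\<bar> \<le> norm a * norm b" by (rule Cauchy_Schwarz_ineq2)
  also have "\<dots> \<le> (norm a)\<^sup>2 + (norm b)\<^sup>2"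
  proof -
    have "0 \<le> norm a * norm b" by simp
    thus ?thesis using sum_squares_bound[of "norm a" "norm b"] by linarith
  qed
  finally show ?thesis .
qed

lemma integrable_inner_sqint:
  fixes f g :: "'a \<Rightarrow> 'b::euclidean_space"
  assumes f: "sqint M f" and g: "sqint M g"
  shows "integrable M (\<lambda>x. f x \<bullet> g x)"
proof (rule Bochner_Integration.integrable_bound)
  show "integrable M (\<lambda>x. (norm (f x))\<^sup>2 + (norm (g x))\<^sup>2)"
    using f g by (simp add: sqint_def)
  show "(\<lambda>x. f x \<bullet> g x) \<in> borel_measurable M"
    using sqint_measurable[OF f] sqint_measurable[OF g] by simp
  show "AE x in M. norm (f x \<bullet> g x) \<le> norm ((norm (f x))\<^sup>2 + (norm (g x))\<^sup>2)"
    using abs_inner_le_sum_squares by (intro AE_I2) fastforce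
qed

lemma sqint_scaleR:
  fixes f :: "'a \<Rightarrow> 'b::euclidean_space"
  shows "sqint M f \<Longrightarrow> sqint M (\<lambda>x. c *\<^sub>R f x)"
  by (auto simp: sqint_def power_mult_distrib)

lemma sqint_add:
  fixes f g :: "'a \<Rightarrow> 'b::euclidean_space"
  assumes f: "sqint M f" and g: "sqint M g"
  shows "sqint M (\<lambda>x. f x + g x)"
proof -
  have "integrable M (\<lambda>x. (norm (f x))\<^sup>2 + 2 * (f x \<bullet> g x) + (norm (g x))\<^sup>2)"
    using f g integrable_inner_sqint[OF f g] by (simp add: sqint_def)
  moreover have "(\<lambda>x. (norm (f x + g x))\<^sup>2) = (\<lambda>x. (norm (f x))\<^sup>2 + 2 * (f x \<bullet> g x) + (norm (g x))\<^sup>2)"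
    by (auto simp: power2_norm_eq_inner inner_add_left inner_add_right inner_commute)
  ultimately show ?thesis
    using sqint_measurable[OF f] sqint_measurable[OF g] by (simp add: sqint_def)
qed

lemma sqint_diff:
  fixes f g :: "'a \<Rightarrow> 'b::euclidean_space"
  assumes f: "sqint M f" and g: "sqint M g"
  shows "sqint M (\<lambda>x. f x - g x)"
  using sqint_add[OF f sqint_scaleR[OF g, of "-1"]] by simp

lemma ip_commute: "ip M f g = ip M g f"
  by (simp add: ip_def inner_commute)

lemma ip_add_left:
  assumes "sqint M f" "sqint M g" "sqint M h"
  shows "ip M (\<lambda>x. f x + g x) h = ip M f h + ip M g h"
  using assms by (simp add: ip_def inner_add_left integrable_inner_sqint)

lemma ip_diff_left:
  assumes "sqint M f" "sqint M g" "sqint M h"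
  shows "ip M (\<lambda>x. f x - g x) h = ip M f h - ip M g h"
  using assms by (simp add: ip_def inner_diff_left integrable_inner_sqint)

lemma ip_scaleR_left: "ip M (\<lambda>x. c *\<^sub>R f x) h = c * ip M f h"
  by (simp add: ip_def)

lemma ip_add_right:
  assumes "sqint M f" "sqint M g" "sqint M h"
  shows "ip M h (\<lambda>x. f x + g x) = ip M h f + ip M h g"
  using ip_add_left[OF assms] by (simp add: ip_commute)

lemma ip_diff_right:
  assumes "sqint M f" "sqint M g" "sqint M h"
  shows "ip M h (\<lambda>x. f x - g x) = ip M h f - ip M h g"
  using ip_diff_left[OF assms] by (simp add: ip_commute)

lemma ip_scaleR_right: "ip M h (\<lambda>x. c *\<^sub>R f x) = c * ip M h f"
  by (simp add: ip_def)

lemma ip_self: "ip M f f = (\<integral>x. (norm (f x))\<^sup>2 \<partial>M)"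
  by (simp add: ip_def power2_norm_eq_inner)

lemma ip_self_nonneg: "0 \<le> ip M f f"
  by (simp add: ip_def)

lemma ip_self_add:
  assumes f: "sqint M f" and g: "sqint M g"
  shows "ip M (\<lambda>x. f x + g x) (\<lambda>x. f x + g x) = ip M f f + 2 * ip M f g + ip M g g"
  using sqint_add[OF f g] f g
  by (simp add: ip_add_left ip_add_right ip_commute[of M g f])

lemma ip_self_diff:
  assumes f: "sqint M f" and g: "sqint M g"
  shows "ip M (\<lambda>x. f x - g x) (\<lambda>x. f x - g x) = ip M f f - 2 * ip M f g + ip M g g"
  using sqint_diff[OF f g] f g
  by (simp add: ip_diff_left ip_diff_right ip_commute[of M g f])

lemma sqrt_ip_scaleR: "sqrt (ip M (\<lambda>x. c *\<^sub>R f x) (\<lambda>x. c *\<^sub>R f x)) = \<bar>c\<bar> * sqrt (ip M f f)"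
proof -
  have "ip M (\<lambda>x. c *\<^sub>R f x) (\<lambda>x. c *\<^sub>R f x) = c\<^sup>2 * ip M f f"
    by (simp only: ip_scaleR_left ip_scaleR_right power2_eq_square mult.assoc)
  thus ?thesis by (simp add: real_sqrt_mult)
qed

lemma ip_cong_AE:
  assumes "AE x in M. f x = f' x" "AE x in M. g x = g' x"
    and [measurable]: "f \<in> borel_measurable M" "f' \<in> borel_measurable M" "g \<in> borel_measurable M" "g' \<in> borel_measurable M"
  shows "ip M f g = ip M f' g'"
  unfolding ip_def by (rule integral_cong_AE) (use assms(1,2) in auto)

lemma sqint_mult_bounded:
  fixes f c :: "'a \<Rightarrow> complex"
  assumes f: "sqint M f" and [measurable]: "c \<in> borel_measurable M" and c: "\<And>x. norm (c x) \<le> B"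
  shows "sqint M (\<lambda>x. c x * f x)" "ip M (\<lambda>x. c x * f x) (\<lambda>x. c x * f x) \<le> B\<^sup>2 * ip M f f"
proof -
  have [measurable]: "f \<in> borel_measurable M" by (rule sqint_measurable[OF f])
  have le: "(norm (c x * f x))\<^sup>2 \<le> B\<^sup>2 * (norm (f x))\<^sup>2" for x
    unfolding norm_mult power_mult_distrib by (intro mult_right_mono power_mono c) auto
  have i: "integrable M (\<lambda>x. B\<^sup>2 * (norm (f x))\<^sup>2)" using f by (simp add: sqint_def)
  show s: "sqint M (\<lambda>x. c x * f x)"
    unfolding sqint_def by (intro conjI Bochner_Integration.integrable_bound[OF i]) (use le in auto)
  have "ip M (\<lambda>x. c x * f x) (\<lambda>x. c x * f x) \<le> (\<integral>x. B\<^sup>2 * (norm (f x))\<^sup>2 \<partial>M)"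
    unfolding ip_self using s le i by (intro integral_mono) (auto simp: sqint_def)
  thus "ip M (\<lambda>x. c x * f x) (\<lambda>x. c x * f x) \<le> B\<^sup>2 * ip M f f" by (simp add: ip_self)
qed

text \<open>The first-order condition at a minimum t = 0, applied below to variations of a
  minimiser.\<close>

lemma quadratic_nonneg_linear_coeff_zero:
  fixes b c :: real
  assumes "\<And>t. 0 \<le> 2 * t * b + t\<^sup>2 * c"
  shows "b = 0"
proof (rule ccontr)
  assume "b \<noteq> 0"
  \<comment> \<open>Any k above both 0 and c serves: at t = -b/k the quadratic equals (b^2/k)(c/k -
    2), which is negative whatever the sign of c.\<close>
  define k where "k = \<bar>c\<bar> + 1"
  have k: "k > 0" "c < k" by (auto simp: k_def)
  have "0 \<le> 2 * (- b / k) * b + (- b / k)\<^sup>2 * c" by (rule assms)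
  also have "\<dots> = b\<^sup>2 / k * (c / k - 2)" using k by (simp add: field_simps power2_eq_square)
  also have "\<dots> < 0"
  proof -
    have "b\<^sup>2 / k > 0" using k \<open>b \<noteq> 0\<close> by simp
    moreover have "c / k - 2 < 0" using k by (simp add: field_simps)
    ultimately show ?thesis by (rule mult_pos_neg)
  qed
  finally show False by simp
qed

lemma Cauchy_Schwarz_ip:
  assumes f: "sqint M f" and g: "sqint M g"
  shows "\<bar>ip M f g\<bar> \<le> sqrt (ip M f f) * sqrt (ip M g g)"
proof -
  let ?a = "ip M f f" and ?b = "ip M f g" and ?c = "ip M g g"
  have q: "0 \<le> ?a + 2 * t * ?b + t\<^sup>2 * ?c" for t
  proof -
    have "ip M (\<lambda>x. f x + t *\<^sub>R g x) (\<lambda>x. f x + t *\<^sub>R g x) = ?a + 2 * t * ?b + t\<^sup>2 * ?c"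
      by (subst ip_self_add[OF f sqint_scaleR[OF g]])
        (simp add: ip_scaleR_left ip_scaleR_right power2_eq_square)
    thus ?thesis using ip_self_nonneg by metis
  qed
  have "?b\<^sup>2 \<le> ?a * ?c"
  proof (cases "?c = 0")
    case True
    have "?b = 0"
    proof (rule ccontr)
      assume "?b \<noteq> 0"
      \<comment> \<open>Without a quadratic term the expression is affine in t, and this t gives it
        the value -1.\<close>
      hence "2 * (- (?a + 1) / (2 * ?b)) * ?b = - (?a + 1)" by simp
      with q[of "- (?a + 1) / (2 * ?b)"] True show False by simp
    qed
    thus ?thesis using True by simp
  next
    case False
    hence c: "?c > 0" using ip_self_nonneg[of M g] by simp
    have "0 \<le> ?a + 2 * (- ?b / ?c) * ?b + (- ?b / ?c)\<^sup>2 * ?c" by (rule q)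
    also have "\<dots> = ?a - ?b\<^sup>2 / ?c" using c by (simp add: field_simps power2_eq_square)
    finally show ?thesis using c by (simp add: field_simps)
  qed
  hence "sqrt (?b\<^sup>2) \<le> sqrt (?a * ?c)" by (rule real_sqrt_le_mono)
  thus ?thesis by (simp add: real_sqrt_mult)
qed

lemma sqrt_ip_triangle:
  assumes f: "sqint M f" and g: "sqint M g"
  shows "sqrt (ip M (\<lambda>x. f x + g x) (\<lambda>x. f x + g x)) \<le> sqrt (ip M f f) + sqrt (ip M g g)"
proof (rule real_le_lsqrt)
  show "0 \<le> sqrt (ip M f f) + sqrt (ip M g g)" using ip_self_nonneg by (intro add_nonneg_nonneg) auto
  have "ip M (\<lambda>x. f x + g x) (\<lambda>x. f x + g x) = ip M f f + 2 * ip M f g + ip M g g"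
    by (rule ip_self_add[OF f g])
  also have "\<dots> \<le> ip M f f + 2 * (sqrt (ip M f f) * sqrt (ip M g g)) + ip M g g"
    using Cauchy_Schwarz_ip[OF f g] by linarith
  also have "\<dots> = (sqrt (ip M f f) + sqrt (ip M g g))\<^sup>2"
    using ip_self_nonneg[of M f] ip_self_nonneg[of M g] by (simp add: power2_sum)
  finally show "ip M (\<lambda>x. f x + g x) (\<lambda>x. f x + g x) \<le> (sqrt (ip M f f) + sqrt (ip M g g))\<^sup>2" .
qed

lemma tendsto_ip:
  assumes f: "sqint M f" and g: "sqint M g"
    and F: "\<And>k. sqint M (F k)" and G: "\<And>k. sqint M (G k)"
    and limF: "(\<lambda>k. ip M (\<lambda>x. F k x - f x) (\<lambda>x. F k x - f x)) \<longlonglongrightarrow> 0"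
    and limG: "(\<lambda>k. ip M (\<lambda>x. G k x - g x) (\<lambda>x. G k x - g x)) \<longlonglongrightarrow> 0"
  shows "(\<lambda>k. ip M (F k) (G k)) \<longlonglongrightarrow> ip M f g"
proof -
  let ?a = "\<lambda>k. sqrt (ip M (\<lambda>x. F k x - f x) (\<lambda>x. F k x - f x))"
  let ?b = "\<lambda>k. sqrt (ip M (\<lambda>x. G k x - g x) (\<lambda>x. G k x - g x))"
  have ab: "?a \<longlonglongrightarrow> 0" "?b \<longlonglongrightarrow> 0"
    using tendsto_real_sqrt[OF limF] tendsto_real_sqrt[OF limG] by simp_all
  have eq: "ip M (F k) (G k) - ip M f g =
     ip M (\<lambda>x. F k x - f x) (\<lambda>x. G k x - g x) + ip M (\<lambda>x. F k x - f x) g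
      + ip M f (\<lambda>x. G k x - g x)" for k
    using f g F[of k] G[of k] sqint_diff[OF F[of k] f] sqint_diff[OF G[of k] g]
    by (simp add: ip_diff_left ip_diff_right)
  have "\<bar>ip M (F k) (G k) - ip M f g\<bar> \<le> ?a k * ?b k + ?a k * sqrt (ip M g g) + sqrt (ip M f f) * ?b k" for k
    unfolding eq
    using Cauchy_Schwarz_ip[OF sqint_diff[OF F[of k] f] sqint_diff[OF G[of k] g]]
      Cauchy_Schwarz_ip[OF sqint_diff[OF F[of k] f] g] Cauchy_Schwarz_ip[OF f sqint_diff[OF G[of k] g]]
    by linarith
  moreover have "(\<lambda>k. ?a k * ?b k + ?a k * sqrt (ip M g g) + sqrt (ip M f f) * ?b k) \<longlonglongrightarrow> 0"
    by (rule tendsto_eq_intros ab | simp)+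
  ultimately have "(\<lambda>k. ip M (F k) (G k) - ip M f g) \<longlonglongrightarrow> 0"
    by (intro Lim_null_comparison[where f="\<lambda>k. ip M (F k) (G k) - ip M f g"] always_eventually) auto
  thus ?thesis by (simp add: LIM_zero_iff)
qed

lemma tendsto_ip_const_right:
  assumes "sqint M f" "sqint M g" "\<And>k. sqint M (F k)"
    and "(\<lambda>k. ip M (\<lambda>x. F k x - f x) (\<lambda>x. F k x - f x)) \<longlonglongrightarrow> 0"
  shows "(\<lambda>k. ip M (F k) g) \<longlonglongrightarrow> ip M f g"
  using assms by (intro tendsto_ip) (auto simp: ip_def)

lemma integral_norm_le_sqrt_ip:
  fixes f :: "'a \<Rightarrow> 'b::euclidean_space"
  assumes M: "emeasure M (space M) = 1" and f: "sqint M f"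
  shows "integrable M (\<lambda>x. norm (f x))" "(\<integral>x. norm (f x) \<partial>M) \<le> sqrt (ip M f f)"
proof -
  interpret finite_measure M by standard (simp add: M)
  have 1: "sqint M (\<lambda>x. 1::real)" by (simp add: sqint_def)
  have n: "sqint M (\<lambda>x. norm (f x))" using f sqint_measurable[OF f] by (simp add: sqint_def)
  show "integrable M (\<lambda>x. norm (f x))" using integrable_inner_sqint[OF n 1] by simp
  have "measure M (space M) = 1" using M by (simp add: measure_def)
  thus "(\<integral>x. norm (f x) \<partial>M) \<le> sqrt (ip M f f)"
    using Cauchy_Schwarz_ip[OF n 1] by (simp add: ip_def power2_norm_eq_inner[symmetric] power2_eq_square)
qed

section \<open>Completeness and minimisation over affine sets\<close>

text \<open>The completeness argument of Riesz and Fischer, for a sequence that already has a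
  geometric rate. Consecutive differences have mean absolute value at most sqrt C / 2^k, so their
  sum is finite almost everywhere and the sequence converges pointwise there.\<close>

lemma L2_limit_exists:
  fixes F :: "nat \<Rightarrow> 'a \<Rightarrow> 'b::euclidean_space"
  assumes M: "emeasure M (space M) = 1" and F: "\<And>k. sqint M (F k)"
    and cauchy: "\<And>k l. k \<le> l \<Longrightarrow> ip M (\<lambda>x. F l x - F k x) (\<lambda>x. F l x - F k x) \<le> C * (1/4)^k"
  obtains f where "sqint M f" "(\<lambda>k. ip M (\<lambda>x. F k x - f x) (\<lambda>x. F k x - f x)) \<longlonglongrightarrow> 0"
proof -
  note [measurable] = sqint_measurable[OF F]
  have C: "C \<ge> 0" using cauchy[of 0 0] ip_self_nonneg[of M "\<lambda>x. F 0 x - F 0 x"] by simp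
  let ?d = "\<lambda>k x. F (Suc k) x - F k x"
  have d: "sqint M (?d k)" for k using F by (intro sqint_diff)
  have dle: "(\<integral>\<^sup>+ x. ennreal (norm (?d k x)) \<partial>M) \<le> ennreal (sqrt C * (1/2)^k)" for k
  proof -
    have "(\<integral>\<^sup>+ x. ennreal (norm (?d k x)) \<partial>M) = ennreal (\<integral>x. norm (?d k x) \<partial>M)"
      by (intro nn_integral_eq_integral integral_norm_le_sqrt_ip[OF M d]) auto
    also have "\<dots> \<le> ennreal (sqrt C * (1/2)^k)"
    proof (rule ennreal_leI)
      have "(\<integral>x. norm (?d k x) \<partial>M) \<le> sqrt (ip M (?d k) (?d k))"
        by (rule integral_norm_le_sqrt_ip[OF M d])
      also have "\<dots> \<le> sqrt (C * (1/4)^k)" by (intro real_sqrt_le_mono cauchy) simp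
      also have "\<dots> = sqrt C * (1/2)^k"
      proof -
        have "sqrt ((1/4)^k) = (1/2)^k"
          by (rule real_sqrt_unique) (simp_all add: power2_eq_square power_mult_distrib[symmetric])
        thus ?thesis by (simp add: real_sqrt_mult)
      qed
      finally show "(\<integral>x. norm (?d k x) \<partial>M) \<le> sqrt C * (1/2)^k" .
    qed
    finally show ?thesis .
  qed
  have "(\<integral>\<^sup>+ x. (\<Sum>k. ennreal (norm (?d k x))) \<partial>M) = (\<Sum>k. \<integral>\<^sup>+ x. ennreal (norm (?d k x)) \<partial>M)"
    by (intro nn_integral_suminf) simp
  also have "\<dots> \<le> (\<Sum>k. ennreal (sqrt C * (1/2)^k))"
    by (intro suminf_le dle) auto
  also have "\<dots> = ennreal (\<Sum>k. sqrt C * (1/2)^k)"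
    using C by (intro suminf_ennreal2) (auto intro!: summable_mult summable_geometric)
  also have "\<dots> < \<infinity>" by simp
  finally have "AE x in M. (\<Sum>k. ennreal (norm (?d k x))) \<noteq> \<infinity>"
    by (intro nn_integral_PInf_AE) auto
  hence conv: "AE x in M. convergent (\<lambda>k. F k x)"
  proof eventually_elim
    case (elim x)
    hence "summable (\<lambda>k. norm (?d k x))"
      by (intro summable_suminf_not_top) (auto simp: top_ennreal_def[symmetric] infinity_ennreal_def)
    hence "summable (\<lambda>k. ?d k x)" by (rule summable_norm_cancel)
    hence "convergent (\<lambda>n. \<Sum>k<n. ?d k x)" by (simp add: summable_iff_convergent)
    hence "convergent (\<lambda>n. (F n x - F 0 x))"
      by (simp add: sum_lessThan_telescope[of "\<lambda>k. F k x"])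
    then show ?case using convergent_diff_const_right_iff by blast
  qed
  \<comment> \<open>\<open>lim\<close> gives a measurable function on the whole space; its values on
    the null set of divergence do not affect the integrals.\<close>
  define f where "f x = lim (\<lambda>k. F k x)" for x
  have [measurable]: "f \<in> borel_measurable M" unfolding f_def by measurable
  have lim: "AE x in M. (\<lambda>k. F k x) \<longlonglongrightarrow> f x"
    using conv by eventually_elim (simp add: f_def convergent_LIMSEQ_iff)
  \<comment> \<open>Fatou's lemma with k fixed and l tending to infinity carries the Cauchy bound
    over to the pointwise limit.\<close>
  have fat: "(\<integral>\<^sup>+ x. ennreal ((norm (F k x - f x))\<^sup>2) \<partial>M) \<le> ennreal (C * (1/4)^k)" for k
  proof -
    have "(\<integral>\<^sup>+ x. ennreal ((norm (F k x - f x))\<^sup>2) \<partial>M)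
        = (\<integral>\<^sup>+ x. liminf (\<lambda>l. ennreal ((norm (F l x - F k x))\<^sup>2)) \<partial>M)"
    proof (intro nn_integral_cong_AE, use lim in eventually_elim)
      case (elim x)
      have "(\<lambda>l. ennreal ((norm (F l x - F k x))\<^sup>2)) \<longlonglongrightarrow> ennreal ((norm (f x - F k x))\<^sup>2)"
        by (intro tendsto_ennrealI tendsto_intros elim)
      from lim_imp_Liminf[OF _ this] show ?case by (simp add: norm_minus_commute)
    qed
    also have "\<dots> \<le> liminf (\<lambda>l. \<integral>\<^sup>+ x. ennreal ((norm (F l x - F k x))\<^sup>2) \<partial>M)"
      by (intro nn_integral_liminf) measurable
    also have "\<dots> \<le> liminf (\<lambda>l. ennreal (C * (1/4)^k))"
    proof (rule Liminf_mono)
      show "\<forall>\<^sub>F l in sequentially. (\<integral>\<^sup>+ x. ennreal ((norm (F l x - F k x))\<^sup>2) \<partial>M) \<le> ennreal (C * (1/4)^k)"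
        using eventually_ge_at_top[of k]
      proof eventually_elim
        case (elim l)
        have "(\<integral>\<^sup>+ x. ennreal ((norm (F l x - F k x))\<^sup>2) \<partial>M) = ennreal (\<integral>x. (norm (F l x - F k x))\<^sup>2 \<partial>M)"
          using sqint_diff[OF F[of l] F[of k]] by (intro nn_integral_eq_integral) (auto simp: sqint_def)
        also have "\<dots> \<le> ennreal (C * (1/4)^k)"
          using cauchy[OF elim] by (intro ennreal_leI) (simp add: ip_self)
        finally show ?case .
      qed
    qed
    also have "\<dots> = ennreal (C * (1/4)^k)" by (intro lim_imp_Liminf) auto
    finally show ?thesis .
  qed
  have diff: "sqint M (\<lambda>x. F k x - f x)" for k
    unfolding sqint_def
    by (intro conjI integrableI_bounded) (auto intro: le_less_trans[OF fat])
  have bd: "ip M (\<lambda>x. F k x - f x) (\<lambda>x. F k x - f x) \<le> C * (1/4)^k" for k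
  proof -
    have "ennreal (ip M (\<lambda>x. F k x - f x) (\<lambda>x. F k x - f x)) = (\<integral>\<^sup>+ x. ennreal ((norm (F k x - f x))\<^sup>2) \<partial>M)"
      using diff[of k] unfolding ip_self
      by (intro nn_integral_eq_integral[symmetric]) (auto simp: sqint_def)
    also have "\<dots> \<le> ennreal (C * (1/4)^k)" by (rule fat)
    finally show ?thesis using C by simp
  qed
  show ?thesis
  proof
    show "sqint M f" using sqint_diff[OF F[of 0] diff[of 0]] by simp
    have "(\<lambda>k. C * (1/4)^k) \<longlonglongrightarrow> C * 0" by (intro tendsto_intros LIMSEQ_power_zero) auto
    hence "(\<lambda>k. C * (1/4)^k) \<longlonglongrightarrow> 0" by simp
    thus "(\<lambda>k. ip M (\<lambda>x. F k x - f x) (\<lambda>x. F k x - f x)) \<longlonglongrightarrow> 0"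
      by (intro tendsto_sandwich[OF _ _ tendsto_const \<open>(\<lambda>k. C * (1/4)^k) \<longlonglongrightarrow> 0\<close>])
        (simp_all add: bd ip_self_nonneg del: power_one_over)
  qed
qed

text \<open>The point of least norm in the closure of an affine set. As \<open>S\<close> is not
  assumed closed, \<open>u\<close> may lie outside it and is delivered with a sequence from
  \<open>S\<close> converging to it. The last conclusion says that u is orthogonal to g - u for
  every g in \<open>S\<close>.\<close>

lemma affine_minimizer:
  fixes S :: "('a \<Rightarrow> 'b::euclidean_space) set"
  assumes M: "emeasure M (space M) = 1" and S: "\<And>f. f \<in> S \<Longrightarrow> sqint M f" and "S \<noteq> {}"
    and affine: "\<And>f g t. f \<in> S \<Longrightarrow> g \<in> S \<Longrightarrow> (\<lambda>x. f x + t *\<^sub>R (g x - f x)) \<in> S"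
    and lb: "\<And>f. f \<in> S \<Longrightarrow> c \<le> ip M f f"
  obtains u F where "sqint M u" "\<And>k. F k \<in> S"
    "(\<lambda>k. ip M (\<lambda>x. F k x - u x) (\<lambda>x. F k x - u x)) \<longlonglongrightarrow> 0"
    "c \<le> ip M u u" "\<And>g. g \<in> S \<Longrightarrow> ip M u g = ip M u u"
proof -
  let ?N = "\<lambda>f. ip M f f"
  define m where "m = Inf (?N ` S)"
  have bdd: "bdd_below (?N ` S)" by (rule bdd_belowI[of _ c]) (use lb in auto)
  have mle: "m \<le> ?N f" if "f \<in> S" for f
    unfolding m_def using that bdd by (intro cInf_lower) auto
  have "\<exists>f\<in>S. ?N f < m + (1/4)^k" for k :: nat
  proof -
    have "Inf (?N ` S) < m + (1/4)^k" by (simp add: m_def)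
    then show ?thesis using \<open>S \<noteq> {}\<close> bdd by (subst (asm) cInf_less_iff) auto
  qed
  then obtain F where F: "\<And>k. F k \<in> S" "\<And>k. ?N (F k) < m + (1/4)^k" by metis
  have cauchy: "?N (\<lambda>x. F l x - F k x) \<le> 4 * (1/4)^k" if "k \<le> l" for k l
  proof -
    have s: "sqint M (F k)" "sqint M (F l)" using F S by auto
    \<comment> \<open>The midpoint lies in \<open>S\<close>, so its squared norm is at least m. If
      the squared norms of the two ends exceed m by at most a and b, with b <= a, the parallelogram
      law bounds the squared distance by 2a + 2b <= 4a.\<close>
    let ?h = "\<lambda>x. F k x + (1/2) *\<^sub>R (F l x - F k x)"
    have "?h = (\<lambda>x. (1/2) *\<^sub>R F k x + (1/2) *\<^sub>R F l x)"
      by (auto simp: algebra_simps scaleR_2[symmetric] simp flip: scaleR_add_left)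
    hence "?N ?h = (?N (F k) + 2 * ip M (F k) (F l) + ?N (F l)) / 4"
      using ip_self_add[OF sqint_scaleR[OF s(1), of "1/2"] sqint_scaleR[OF s(2), of "1/2"]]
      by (simp add: ip_scaleR_left ip_scaleR_right field_simps)
    moreover have "m \<le> ?N ?h" by (intro mle affine F)
    moreover have "?N (\<lambda>x. F l x - F k x) = ?N (F l) - 2 * ip M (F k) (F l) + ?N (F k)"
      using ip_self_diff[OF s(2,1)] by (simp add: ip_commute)
    moreover have "(1/4::real)^l \<le> (1/4)^k" using that by (intro power_decreasing) auto
    moreover have "A \<le> 4 * a" if "H = (B + 2 * I + D) / 4" "m \<le> H" "A = D - 2 * I + B" "b \<le> a"
      "B < m + a" "D < m + b" for A B D H I a b :: real
    proof -
      have "A = 2 * D + 2 * B - 4 * H" using that(1,3) by (simp add: field_simps)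
      thus ?thesis using that(2,4-6) by linarith
    qed
    ultimately show ?thesis using F(2)[of k] F(2)[of l] by blast
  qed
  obtain u where u: "sqint M u" "(\<lambda>k. ?N (\<lambda>x. F k x - u x)) \<longlonglongrightarrow> 0"
    using L2_limit_exists[OF M S[OF F(1)] cauchy] by blast
  have Nu: "?N u = m"
  proof (rule LIMSEQ_unique)
    show "(\<lambda>k. ?N (F k)) \<longlonglongrightarrow> ?N u" using u F S by (intro tendsto_ip) auto
    have "(\<lambda>k. m + (1/4)^k) \<longlonglongrightarrow> m + 0" by (intro tendsto_intros LIMSEQ_power_zero) auto
    hence "(\<lambda>k. m + (1/4)^k) \<longlonglongrightarrow> m" by simp
    thus "(\<lambda>k. ?N (F k)) \<longlonglongrightarrow> m"
      by (intro tendsto_sandwich[OF _ _ tendsto_const \<open>(\<lambda>k. m + (1/4)^k) \<longlonglongrightarrow> m\<close>])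
        (simp_all add: mle F(1) less_imp_le[OF F(2)] del: power_one_over)
  qed
  show ?thesis
  proof
    show "sqint M u" "(\<lambda>k. ?N (\<lambda>x. F k x - u x)) \<longlonglongrightarrow> 0" by (fact u)+
    show "F k \<in> S" for k by (fact F)
    show "c \<le> ?N u" unfolding Nu m_def using \<open>S \<noteq> {}\<close> lb by (intro cInf_greatest) auto
    fix g assume g: "g \<in> S"
    \<comment> \<open>The competitor u + t (g - u) need not belong to \<open>S\<close>, but it is
      the limit of F k + t (g - F k), which does; hence its squared norm is still at least
      m.\<close>
    have "0 \<le> 2 * t * (ip M u g - ?N u) + t\<^sup>2 * ?N (\<lambda>x. g x - u x)" for t
    proof -
      have s: "sqint M (\<lambda>x. F k x + t *\<^sub>R (g x - F k x))" for k using F g S affine by auto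
      have su: "sqint M (\<lambda>x. u x + t *\<^sub>R (g x - u x))"
        by (intro sqint_add u sqint_scaleR sqint_diff S g)
      have "(\<lambda>k. ?N (\<lambda>x. F k x + t *\<^sub>R (g x - F k x))) \<longlonglongrightarrow> ?N (\<lambda>x. u x + t *\<^sub>R (g x - u x))"
      proof (rule tendsto_ip[OF su su s s])
        have "(\<lambda>x. F k x + t *\<^sub>R (g x - F k x) - (u x + t *\<^sub>R (g x - u x)))
            = (\<lambda>x. (1 - t) *\<^sub>R (F k x - u x))" for k
          by (auto simp: algebra_simps)
        hence eq: "?N (\<lambda>x. F k x + t *\<^sub>R (g x - F k x) - (u x + t *\<^sub>R (g x - u x)))
            = (1 - t)\<^sup>2 * ?N (\<lambda>x. F k x - u x)" for k
          by (simp add: ip_scaleR_left ip_scaleR_right power2_eq_square)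
        have "(\<lambda>k. (1 - t)\<^sup>2 * ?N (\<lambda>x. F k x - u x)) \<longlonglongrightarrow> (1 - t)\<^sup>2 * 0"
          by (intro tendsto_intros u)
        thus "(\<lambda>k. ?N (\<lambda>x. F k x + t *\<^sub>R (g x - F k x) - (u x + t *\<^sub>R (g x - u x)))) \<longlonglongrightarrow> 0"
          "(\<lambda>k. ?N (\<lambda>x. F k x + t *\<^sub>R (g x - F k x) - (u x + t *\<^sub>R (g x - u x)))) \<longlonglongrightarrow> 0"
          unfolding eq by simp_all
      qed
      hence "m \<le> ?N (\<lambda>x. u x + t *\<^sub>R (g x - u x))"
        by (rule LIMSEQ_le_const) (use mle affine F g in blast)
      also have "\<dots> = ?N u + 2 * t * (ip M u g - ?N u) + t\<^sup>2 * ?N (\<lambda>x. g x - u x)"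
        using ip_self_add[OF u(1) sqint_scaleR[OF sqint_diff[OF S[OF g] u(1)], of t]] S[OF g] u(1)
        by (simp add: ip_scaleR_left ip_scaleR_right ip_diff_right power2_eq_square)
      finally show ?thesis by (simp add: Nu)
    qed
    thus "ip M u g = ?N u" using quadratic_nonneg_linear_coeff_zero by force
  qed
qed

subsection \<open>The Chebyshev distribution and powers on the circle\<close>

lemma integrable_mult_AE_bounded:
  fixes f g :: "'a \<Rightarrow> real"
  assumes f: "integrable M f" and [measurable]: "g \<in> borel_measurable M" and B: "AE x in M. \<bar>g x\<bar> \<le> B"
  shows "integrable M (\<lambda>x. f x * g x)"
proof (rule Bochner_Integration.integrable_bound)
  show "integrable M (\<lambda>x. B * f x)" using f by simp
  show "(\<lambda>x. f x * g x) \<in> borel_measurable M" using f by measurable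
  show "AE x in M. norm (f x * g x) \<le> norm (B * f x)" using B
  proof eventually_elim
    case (elim x)
    have "\<bar>f x\<bar> * \<bar>g x\<bar> \<le> \<bar>f x\<bar> * \<bar>B\<bar>" using elim by (intro mult_left_mono) auto
    thus ?case by (simp add: abs_mult mult.commute)
  qed
qed

lemma sqint_AE_bounded:
  fixes f :: "'a \<Rightarrow> 'b::euclidean_space"
  assumes M: "emeasure M (space M) = 1" and [measurable]: "f \<in> borel_measurable M"
    and B: "AE x in M. norm (f x) \<le> B"
  shows "sqint M f"
proof -
  interpret finite_measure M by standard (simp add: M)
  have "AE x in M. norm ((norm (f x))\<^sup>2) \<le> B\<^sup>2"
    using B by eventually_elim (auto intro: power_mono)
  hence "integrable M (\<lambda>x. (norm (f x))\<^sup>2)" by (rule integrable_const_bound) simp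
  thus ?thesis by (simp add: sqint_def)
qed

text \<open>Bessel's inequality makes the squared coefficients summable, so they tend to 0.\<close>

lemma ip_tendsto_zero_orthonormal:
  fixes e :: "nat \<Rightarrow> 'a \<Rightarrow> 'b::euclidean_space"
  assumes e: "\<And>k. sqint M (e k)" and orth: "\<And>j k. ip M (e j) (e k) = (if j = k then 1 else 0)"
    and g: "sqint M g"
  shows "(\<lambda>k. ip M g (e k)) \<longlonglongrightarrow> 0"
proof -
  define a where "a k = ip M g (e k)" for k
  \<comment> \<open>Here s is what remains of g after its first K projections are removed. It keeps
    the coefficients of g at all later indices, which is what lets the induction continue.\<close>
  have "\<exists>s. sqint M s \<and> (\<forall>k\<ge>K. ip M s (e k) = a k) \<and> ip M s s = ip M g g - (\<Sum>k<K. (a k)\<^sup>2)" for K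
  proof (induction K)
    case 0
    show ?case using g by (intro exI[of _ g]) (auto simp: a_def)
  next
    case (Suc K)
    then obtain s where s: "sqint M s" "\<And>k. k \<ge> K \<Longrightarrow> ip M s (e k) = a k"
      "ip M s s = ip M g g - (\<Sum>k<K. (a k)\<^sup>2)" by blast
    let ?s = "\<lambda>x. s x - a K *\<^sub>R e K x"
    have "sqint M ?s" by (intro sqint_diff s sqint_scaleR e)
    moreover have "ip M ?s (e k) = a k" if "k \<ge> Suc K" for k
      using s that by (subst ip_diff_left) (auto simp: sqint_scaleR e ip_scaleR_left orth)
    moreover have "ip M ?s ?s = ip M g g - (\<Sum>k<Suc K. (a k)\<^sup>2)"
      using s by (subst ip_self_diff)
        (auto simp: sqint_scaleR e ip_scaleR_left ip_scaleR_right orth power2_eq_square)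
    ultimately show ?case by blast
  qed
  hence "(\<Sum>k<K. (a k)\<^sup>2) \<le> ip M g g" for K
    using ip_self_nonneg by (metis diff_ge_0_iff_ge)
  hence "summable (\<lambda>k. (a k)\<^sup>2)"
    by (intro summableI_nonneg_bounded) auto
  hence "(\<lambda>k. (a k)\<^sup>2) \<longlonglongrightarrow> 0" by (rule summable_LIMSEQ_zero)
  hence "(\<lambda>k. sqrt ((a k)\<^sup>2)) \<longlonglongrightarrow> sqrt 0" by (rule tendsto_real_sqrt)
  thus ?thesis by (simp add: a_def tendsto_rabs_zero_iff)
qed

text \<open>The arcsine law, that is, the distribution of cos theta for theta uniform on [0, pi].
  The real \<open>sqrt\<close> is negative at negative arguments, so the indicator keeps the
  real-valued density nonnegative.\<close>

definition cheb_measure :: "real measure" where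
  "cheb_measure = density lborel (\<lambda>x. ennreal (indicator {-1..1} x * cheb_rho x))"

text \<open>The argument is clamped so that \<open>norm (circ x) = 1\<close> holds for every real \<open>x\<close>;
  \<open>Re (circ x) = x\<close> only on \<open>[-1, 1]\<close>.\<close>

definition circ :: "real \<Rightarrow> complex" where
  "circ x = (let y = max (-1) (min 1 x) in Complex y (sqrt (1 - y\<^sup>2)))"

lemma cheb_rho_nonneg: "x \<in> {-1..1} \<Longrightarrow> 0 \<le> cheb_rho x"
  by (auto simp: cheb_rho_def abs_square_le_1 abs_le_iff)

lemma indicator_cheb_rho_nonneg: "0 \<le> indicator {-1..1} x * cheb_rho x"
  using cheb_rho_nonneg by (auto split: split_indicator)

lemma measurable_cheb_rho [measurable]: "cheb_rho \<in> borel_measurable borel"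
  unfolding cheb_rho_def[abs_def] by measurable

text \<open>The substitution x = cos theta in the form of an explicit antiderivative. The density is
  unbounded near the endpoints, so the fundamental theorem is used with derivatives in the interior
  and continuity on the closed interval.\<close>

lemma cheb_rho_moment_has_integral:
  "((\<lambda>x. cos (real k * arccos x) * cheb_rho x) has_integral (if k = 0 then 1 else 0)) {-1..1}"
proof (cases "k = 0")
  case True
  let ?F = "\<lambda>x. - arccos x / pi"
  have "((\<lambda>x. cos (real k * arccos x) * cheb_rho x) has_integral (?F 1 - ?F (-1))) {-1..1}"
  proof (rule fundamental_theorem_of_calculus_interior)
    show "continuous_on {-1..1} ?F" by (intro continuous_intros) auto
    fix x :: real assume x: "x \<in> {-1<..<1}"
    hence "sqrt (1 - x\<^sup>2) \<noteq> 0" by (auto simp: power2_eq_1_iff)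
    with x have "(?F has_real_derivative cos (real k * arccos x) * cheb_rho x) (at x)"
      using True by (auto intro!: derivative_eq_intros simp: cheb_rho_def field_simps)
    thus "(?F has_vector_derivative cos (real k * arccos x) * cheb_rho x) (at x)"
      by (simp add: has_real_derivative_iff_has_vector_derivative)
  qed simp
  thus ?thesis using True by simp
next
  case False
  let ?F = "\<lambda>x. - sin (real k * arccos x) / (real k * pi)"
  have "((\<lambda>x. cos (real k * arccos x) * cheb_rho x) has_integral (?F 1 - ?F (-1))) {-1..1}"
  proof (rule fundamental_theorem_of_calculus_interior)
    show "continuous_on {-1..1} ?F" using False by (intro continuous_intros) auto
    fix x :: real assume x: "x \<in> {-1<..<1}"
    hence "sqrt (1 - x\<^sup>2) \<noteq> 0" by (auto simp: power2_eq_1_iff)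
    with x False have "(?F has_real_derivative cos (real k * arccos x) * cheb_rho x) (at x)"
      by (auto intro!: derivative_eq_intros simp: cheb_rho_def field_simps)
    thus "(?F has_vector_derivative cos (real k * arccos x) * cheb_rho x) (at x)"
      by (simp add: has_real_derivative_iff_has_vector_derivative)
  qed simp
  thus ?thesis using False by (simp add: mult.commute)
qed

lemma nn_integral_cheb_rho: "(\<integral>\<^sup>+ x. ennreal (indicator {-1..1} x * cheb_rho x) \<partial>lborel) = 1"
proof -
  have "(cheb_rho has_integral 1) {-1..1}" using cheb_rho_moment_has_integral[of 0] by simp
  hence "((\<lambda>x. indicator {-1..1} x * cheb_rho x) has_integral 1) UNIV"
    using has_integral_restrict_UNIV[of "{-1..1}" cheb_rho 1]
    by (simp add: indicator_def of_bool_def if_distrib[of "\<lambda>c. c * _"] cong: if_cong)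
  from nn_integral_has_integral_lborel[OF _ _ this] show ?thesis
    using indicator_cheb_rho_nonneg by simp
qed

lemma sets_cheb_measure [measurable_cong, simp]: "sets cheb_measure = sets borel"
  by (simp add: cheb_measure_def)

lemma space_cheb_measure [simp]: "space cheb_measure = UNIV"
  by (simp add: cheb_measure_def)

lemma emeasure_cheb_measure_UNIV: "emeasure cheb_measure (space cheb_measure) = 1"
  using nn_integral_cheb_rho by (simp add: cheb_measure_def emeasure_density)

interpretation cheb: finite_measure cheb_measure
  by standard (simp add: emeasure_cheb_measure_UNIV[simplified])

lemma measure_cheb_measure_UNIV [simp]: "measure cheb_measure UNIV = 1"
  using emeasure_cheb_measure_UNIV by (simp add: measure_def)

lemma AE_cheb_measure_interior: "AE x in cheb_measure. \<bar>x\<bar> < 1"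
  unfolding cheb_measure_def
proof (subst AE_density)
  show "AE x in lborel. 0 < ennreal (indicator {-1..1} x * cheb_rho x) \<longrightarrow> \<bar>x\<bar> < 1"
  proof (rule AE_I2, rule impI)
    fix x :: real assume "0 < ennreal (indicator {-1..1} x * cheb_rho x)"
    hence "x \<in> {-1..1}" "cheb_rho x \<noteq> 0" by (auto split: split_indicator_asm)
    \<comment> \<open>At the endpoints the denominator is 0, so \<open>cheb_rho\<close> is 0 there
      by the convention for division.\<close>
    thus "\<bar>x\<bar> < 1" by (cases "\<bar>x\<bar> = 1") (auto simp: cheb_rho_def abs_square_eq_1)
  qed
qed simp

lemma integral_cheb_measure:
  fixes f :: "real \<Rightarrow> real"
  assumes "f \<in> borel_measurable borel"
  shows "(\<integral>x. f x \<partial>cheb_measure) = (\<integral>x. indicator {-1..1} x * cheb_rho x * f x \<partial>lborel)"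
    and "integrable cheb_measure f \<longleftrightarrow> integrable lborel (\<lambda>x. indicator {-1..1} x * cheb_rho x * f x)"
  unfolding cheb_measure_def using assms indicator_cheb_rho_nonneg
  by (simp_all add: integral_real_density integrable_real_density)

lemma norm_circ [simp]: "norm (circ x) = 1"
proof -
  define y where "y = max (-1) (min 1 x)"
  have "y\<^sup>2 \<le> 1" unfolding y_def by (auto simp: abs_square_le_1 abs_le_iff)
  thus ?thesis by (simp add: circ_def y_def[symmetric] Let_def cmod_def)
qed

lemma Re_circ: "\<bar>x\<bar> \<le> 1 \<Longrightarrow> Re (circ x) = x"
  by (auto simp: circ_def Let_def)

lemma circ_eq_cis_arccos: "\<bar>x\<bar> \<le> 1 \<Longrightarrow> circ x = cis (arccos x)"
  by (auto simp: circ_def Let_def complex_eq_iff sin_arccos_abs max_def min_def abs_le_iff)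

lemma continuous_circ: "continuous_on UNIV circ"
proof -
  have "circ = (\<lambda>x. complex_of_real (max (-1) (min 1 x)) + \<i> * complex_of_real (sqrt (1 - (max (-1) (min 1 x))\<^sup>2)))"
    by (auto simp: circ_def Let_def complex_eq_iff fun_eq_iff)
  show ?thesis unfolding \<open>circ = _\<close> by (intro continuous_intros)
qed

lemma measurable_circ [measurable]: "circ \<in> borel_measurable borel"
  by (rule borel_measurable_continuous_onI[OF continuous_circ])

lemma integral_Re_circ_power:
  "(\<integral>x. Re (circ x ^ k) \<partial>cheb_measure) = (if k = 0 then 1 else 0)"
proof -
  have m: "(\<lambda>x. Re (circ x ^ k)) \<in> borel_measurable borel" by measurable
  have "integrable cheb_measure (\<lambda>x. Re (circ x ^ k))"
    using order_trans[OF abs_Re_le_cmod]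
    by (intro cheb.integrable_const_bound[of _ 1]) (auto simp: norm_power)
  hence "integrable lborel (\<lambda>x. indicator {-1..1} x * cheb_rho x * Re (circ x ^ k))"
    using integral_cheb_measure(2)[OF m] by simp
  from has_integral_integral_lborel[OF this]
  have "((\<lambda>x. indicator {-1..1} x * cheb_rho x * Re (circ x ^ k)) has_integral
      (\<integral>x. Re (circ x ^ k) \<partial>cheb_measure)) UNIV"
    by (simp add: integral_cheb_measure(1)[OF m])
  moreover have "(\<lambda>x. indicator {-1..1} x * cheb_rho x * Re (circ x ^ k)) =
      (\<lambda>x. if x \<in> {-1..1} then cos (real k * arccos x) * cheb_rho x else 0)"
    by (auto simp: fun_eq_iff circ_eq_cis_arccos Complex.DeMoivre abs_le_iff split: split_indicator)
  ultimately have "((\<lambda>x. cos (real k * arccos x) * cheb_rho x) has_integral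
      (\<integral>x. Re (circ x ^ k) \<partial>cheb_measure)) {-1..1}"
    by (simp only: has_integral_restrict_UNIV)
  thus ?thesis using cheb_rho_moment_has_integral has_integral_unique by blast
qed

lemma Re_mult_cnj: "Re (a * cnj b) = a \<bullet> b"
  by (simp add: inner_complex_def)

lemma circ_power_inner: "k \<le> j \<Longrightarrow> circ x ^ j \<bullet> circ x ^ k = Re (circ x ^ (j - k))"
proof -
  assume "k \<le> j"
  hence "circ x ^ j * cnj (circ x ^ k) = circ x ^ (j - k) * (circ x ^ k * cnj (circ x ^ k))"
    by (simp flip: power_add mult.assoc)
  also have "circ x ^ k * cnj (circ x ^ k) = 1"
    by (simp add: complex_norm_square[symmetric] norm_power del: complex_cnj_power)
  finally show ?thesis by (simp add: Re_mult_cnj[symmetric])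
qed

text \<open>On [-1, 1] \<open>circ\<close> covers only the upper half circle, where the powers are
  not orthogonal for the Hermitian product. The real product only involves cos((j - k) theta), whose
  mean over [0, pi] vanishes for distinct j and k.\<close>

lemma ip_circ_powers: "ip cheb_measure (\<lambda>x. circ x ^ j) (\<lambda>x. circ x ^ k) = (if j = k then 1 else 0)"
proof (cases "k \<le> j")
  case True
  thus ?thesis by (auto simp: ip_def circ_power_inner integral_Re_circ_power)
next
  case False
  thus ?thesis by (subst ip_commute) (auto simp: ip_def circ_power_inner integral_Re_circ_power)
qed

lemma Riemann_Lebesgue_circ:
  assumes "sqint cheb_measure g"
  shows "(\<lambda>n. ip cheb_measure g (\<lambda>x. circ x ^ n)) \<longlonglongrightarrow> 0"
  by (rule ip_tendsto_zero_orthonormal[OF _ ip_circ_powers assms])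
    (auto intro!: sqint_AE_bounded[of _ _ 1] emeasure_cheb_measure_UNIV simp: norm_power)

section \<open>Chebyshev polynomials and densities determined by cosine moments\<close>

fun chebT :: "nat \<Rightarrow> real poly" where
  "chebT 0 = 1"
| "chebT (Suc 0) = [:0, 1:]"
| "chebT (Suc (Suc n)) = [:0, 2:] * chebT (Suc n) - chebT n"

text \<open>On the unit circle y^2 + 1 = 2 Re(y) y, which is the Chebyshev recursion for the powers
  of y. An arbitrary unit y is allowed because the identity is applied to \<open>circ x\<close> and
  also to products such as U times a conjugate power of z.\<close>

lemma poly_chebT_Re:
  assumes "norm y = 1"
  shows "poly (chebT n) (Re y) = Re (y ^ n)"
proof (induction n rule: chebT.induct)
  case (3 n)
  have "y * y + 1 = 2 * of_real (Re y) * y"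
  proof -
    have "y * cnj y = 1" using assms by (simp add: complex_norm_square[symmetric])
    moreover have "2 * of_real (Re y) = y + cnj y" by (simp add: complex_add_cnj)
    ultimately show ?thesis by (simp add: algebra_simps)
  qed
  hence "y ^ Suc (Suc n) + y ^ n = of_real (2 * Re y) * y ^ Suc n"
    by (simp add: algebra_simps) (metis distrib_left mult.right_neutral mult.commute mult.assoc)
  from arg_cong[OF this, of Re] have "Re (y ^ Suc (Suc n)) + Re (y ^ n) = 2 * Re y * Re (y ^ Suc n)"
    by (simp del: power_Suc)
  thus ?case using 3 by (simp del: power_Suc)
qed simp_all

lemma degree_lead_coeff_chebT:
  "degree (chebT n) = n \<and> lead_coeff (chebT n) = (if n = 0 then 1 else 2 ^ (n - 1))"
proof (induction n rule: chebT.induct)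
  case (3 n)
  have c0: "chebT (Suc n) \<noteq> 0" using 3 by auto
  have d: "degree ([:0, 2:] * chebT (Suc n)) = Suc (Suc n)"
    using 3 c0 by (subst degree_mult_eq) auto
  have lt: "degree (chebT n) < Suc (Suc n)" using 3 by simp
  hence "degree (chebT (Suc (Suc n))) = Suc (Suc n)"
    using d degree_add_eq_left[of "- chebT n" "[:0, 2:] * chebT (Suc n)"] by simp
  moreover have "coeff (chebT (Suc (Suc n))) (Suc (Suc n)) = 2 ^ Suc n"
  proof -
    have "coeff (chebT (Suc n)) (Suc n) = 2 ^ n" using 3(1) by (metis diff_Suc_1 nat.simps(3))
    thus ?thesis using lt by (simp add: coeff_eq_0)
  qed
  ultimately show ?case by (simp del: chebT.simps)
qed simp_all

text \<open>Subtracting the multiple of the Chebyshev polynomial with the same leading term lowers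
  the degree. Claims linear in a polynomial are thus reduced to Chebyshev polynomials, which become
  powers of z on the circle.\<close>

lemma chebT_span_induct:
  assumes zero: "P 0" and T: "\<And>n. P (chebT n)" and add: "\<And>p q. P p \<Longrightarrow> P q \<Longrightarrow> P (p + q)"
    and smult: "\<And>c p. P p \<Longrightarrow> P (smult c p)"
  shows "P q"
proof (induction "degree q" arbitrary: q rule: less_induct)
  case less
  define c where "c = lead_coeff q / lead_coeff (chebT (degree q))"
  define r where "r = q - smult c (chebT (degree q))"
  have nz: "lead_coeff (chebT (degree q)) \<noteq> 0"
    unfolding degree_lead_coeff_chebT[THEN conjunct2] by simp
  have "coeff r (degree q) = 0"
    using nz degree_lead_coeff_chebT[of "degree q"] by (simp add: r_def c_def)
  moreover have "degree r \<le> degree q"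
    unfolding r_def using degree_lead_coeff_chebT[of "degree q"]
    by (intro degree_diff_le) (auto intro: order_trans[OF degree_smult_le])
  ultimately have "r = 0 \<or> degree r < degree q"
    by (metis leading_coeff_0_iff order_le_less)
  hence "P r" using less zero by auto
  hence "P (r + smult c (chebT (degree q)))" by (intro add smult T)
  thus ?case by (simp add: r_def)
qed

lemma Weierstrass_poly:
  fixes f :: "real \<Rightarrow> real"
  assumes "continuous_on {a..b} f" "e > 0"
  obtains q where "\<And>x. x \<in> {a..b} \<Longrightarrow> \<bar>f x - poly q x\<bar> < e"
proof -
  obtain g where g: "real_polynomial_function g" "\<And>x. x \<in> {a..b} \<Longrightarrow> \<bar>f x - g x\<bar> < e"
    using Stone_Weierstrass_real_polynomial_function[OF compact_Icc assms] by blast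
  then obtain c n where "g = (\<lambda>x. \<Sum>i\<le>n. c i * x ^ i)"
    using real_polynomial_function_iff_sum by blast
  hence "g x = poly (\<Sum>i\<le>n. monom (c i) i) x" for x by (simp add: poly_sum poly_monom)
  with g that show ?thesis by metis
qed

lemma poly_bounded_Icc: "\<exists>B::real. \<forall>x\<in>{-1..1}. \<bar>poly q x\<bar> \<le> B"
proof -
  have "compact (poly q ` {-1..1::real})" by (intro compact_continuous_image) (auto intro!: continuous_intros)
  from compact_imp_bounded[OF this] show ?thesis by (auto simp: bounded_iff)
qed

lemma measurable_poly [measurable]: "(\<lambda>x::real. poly q x) \<in> borel_measurable borel"
  by (intro borel_measurable_continuous_onI continuous_intros)

text \<open>The moments are the integrals of t against Chebyshev polynomials, so t annihilates every
  polynomial. Uniform approximation on [-1, 1] extends this to continuous functions, with an error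
  of at most e times the integral of |t|.\<close>

lemma integral_continuous_zero_of_circ_moments:
  fixes t \<phi> :: "real \<Rightarrow> real"
  assumes t: "integrable cheb_measure t" and mom: "\<And>j. (\<integral>x. t x * Re (circ x ^ j) \<partial>cheb_measure) = 0"
    and \<phi>: "continuous_on UNIV \<phi>" and B: "\<And>x. \<bar>\<phi> x\<bar> \<le> B"
  shows "(\<integral>x. t x * \<phi> x \<partial>cheb_measure) = 0"
proof -
  have I: "AE x in cheb_measure. x \<in> {-1..1}"
    using AE_cheb_measure_interior by eventually_elim auto
  have [measurable]: "\<phi> \<in> borel_measurable borel" by (rule borel_measurable_continuous_onI[OF \<phi>])
  have bdd: "integrable cheb_measure (\<lambda>x. t x * poly q x)" for q
  proof -
    obtain B where "\<forall>x\<in>{-1..1}. \<bar>poly q x\<bar> \<le> B" using poly_bounded_Icc by blast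
    hence "AE x in cheb_measure. \<bar>poly q x\<bar> \<le> B" using I by auto
    thus ?thesis by (intro integrable_mult_AE_bounded[OF t]) auto
  qed
  have poly0: "(\<integral>x. t x * poly q x \<partial>cheb_measure) = 0" for q
  proof (induction q rule: chebT_span_induct)
    case (2 n)
    have "(\<integral>x. t x * poly (chebT n) x \<partial>cheb_measure) = (\<integral>x. t x * Re (circ x ^ n) \<partial>cheb_measure)"
    proof (rule integral_cong_AE)
      show "AE x in cheb_measure. t x * poly (chebT n) x = t x * Re (circ x ^ n)"
        using I by eventually_elim (use poly_chebT_Re[OF norm_circ] in \<open>simp add: Re_circ abs_le_iff flip: poly_chebT_Re\<close>)
    qed (use t in measurable)
    thus ?case using mom by simp
  qed (use bdd in \<open>simp_all add: distrib_left mult.left_commute\<close>)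
  have int: "integrable cheb_measure (\<lambda>x. t x * \<phi> x)"
    by (intro integrable_mult_AE_bounded[OF t, of _ B]) (auto simp: B)
  let ?I = "\<integral>x. t x * \<phi> x \<partial>cheb_measure"
  let ?T = "\<integral>x. \<bar>t x\<bar> \<partial>cheb_measure"
  have "\<bar>?I\<bar> \<le> e * ?T" if e: "e > 0" for e
  proof -
    obtain q where q: "\<And>x. x \<in> {-1..1} \<Longrightarrow> \<bar>\<phi> x - poly q x\<bar> < e"
      using Weierstrass_poly[of "-1" 1 \<phi>, OF continuous_on_subset[OF \<phi>] e] by blast
    have "?I = (\<integral>x. t x * \<phi> x \<partial>cheb_measure) - (\<integral>x. t x * poly q x \<partial>cheb_measure)" by (simp add: poly0)
    also have "\<dots> = (\<integral>x. t x * (\<phi> x - poly q x) \<partial>cheb_measure)"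
      using int bdd by (simp add: right_diff_distrib)
    finally have "\<bar>?I\<bar> = \<bar>\<integral>x. t x * (\<phi> x - poly q x) \<partial>cheb_measure\<bar>" by simp
    also have "\<dots> \<le> (\<integral>x. \<bar>t x * (\<phi> x - poly q x)\<bar> \<partial>cheb_measure)" by (rule integral_abs_bound)
    also have "\<dots> \<le> (\<integral>x. e * \<bar>t x\<bar> \<partial>cheb_measure)"
    proof (rule integral_mono_AE)
      show "integrable cheb_measure (\<lambda>x. \<bar>t x * (\<phi> x - poly q x)\<bar>)"
        using int bdd[of q] by (intro integrable_abs) (simp add: right_diff_distrib)
      show "integrable cheb_measure (\<lambda>x. e * \<bar>t x\<bar>)" using t by simp
      show "AE x in cheb_measure. \<bar>t x * (\<phi> x - poly q x)\<bar> \<le> e * \<bar>t x\<bar>"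
        using I
      proof eventually_elim
        case (elim x)
        have "\<bar>t x\<bar> * \<bar>\<phi> x - poly q x\<bar> \<le> \<bar>t x\<bar> * e" using q[OF elim] by (intro mult_left_mono) auto
        thus ?case by (simp add: abs_mult mult.commute)
      qed
    qed
    also have "\<dots> = e * ?T" by simp
    finally show ?thesis .
  qed
  hence le: "\<bar>?I\<bar> \<le> e * ?T" if "e > 0" for e using that .
  have T: "?T \<ge> 0" by simp
  show ?thesis
  proof (rule ccontr)
    assume "?I \<noteq> 0"
    \<comment> \<open>The number c replaces the integral of |t| in the denominator, since that
      integral may be 0.\<close>
    obtain c where c: "c > 0" "?T < c" by (metis gt_ex le_less_trans T)
    have "\<bar>?I\<bar> / c > 0" using c \<open>?I \<noteq> 0\<close> by (intro divide_pos_pos) auto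
    from le[OF this] have "\<bar>?I\<bar> * c \<le> \<bar>?I\<bar> * ?T"
      using c(1) by (simp only: times_divide_eq_left pos_le_divide_eq)
    hence "c \<le> ?T" using \<open>?I \<noteq> 0\<close> by simp
    thus False using c by linarith
  qed
qed

text \<open>After subtraction of the mean, every cosine moment including the zeroth vanishes. Then
  the measures with densities s and m agree on all open half-lines, hence everywhere, and densities
  are unique almost everywhere.\<close>

lemma AE_const_of_circ_moments:
  fixes s :: "real \<Rightarrow> real"
  assumes s: "integrable cheb_measure s" and nn: "\<And>x. 0 \<le> s x"
    and mom: "\<And>j. j \<ge> 1 \<Longrightarrow> (\<integral>x. s x * Re (circ x ^ j) \<partial>cheb_measure) = 0"
  shows "AE x in cheb_measure. s x = (\<integral>x. s x \<partial>cheb_measure)"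
proof -
  define m where "m = (\<integral>x. s x \<partial>cheb_measure)"
  have m: "m \<ge> 0" using nn by (simp add: m_def)
  have [measurable]: "s \<in> borel_measurable borel" using borel_measurable_integrable[OF s] by simp
  define t where "t x = s x - m" for x
  have t: "integrable cheb_measure t" using s by (simp add: t_def[abs_def])
  have [measurable]: "t \<in> borel_measurable borel" using borel_measurable_integrable[OF t] by simp
  have intRe: "integrable cheb_measure (\<lambda>x. g x * Re (circ x ^ j))" if "integrable cheb_measure g" for g j
    using order_trans[OF abs_Re_le_cmod]
    by (intro integrable_mult_AE_bounded[OF that, of _ 1]) (auto simp: norm_power)
  have momt: "(\<integral>x. t x * Re (circ x ^ j) \<partial>cheb_measure) = 0" for j
  proof -
    have "(\<integral>x. t x * Re (circ x ^ j) \<partial>cheb_measure) =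
      (\<integral>x. s x * Re (circ x ^ j) \<partial>cheb_measure) - (\<integral>x. m * Re (circ x ^ j) \<partial>cheb_measure)"
      unfolding t_def left_diff_distrib using s
      by (intro Bochner_Integration.integral_diff intRe) auto
    thus ?thesis using mom[of j] by (cases "j = 0") (auto simp: integral_Re_circ_power m_def)
  qed
  have ind0: "(\<integral>x. t x * indicator {a<..} x \<partial>cheb_measure) = 0" for a
  proof (rule LIMSEQ_unique)
    \<comment> \<open>Ramps of slope n starting at a. They vanish at a itself, so their pointwise
      limit is the indicator of the open half-line.\<close>
    let ?\<phi> = "\<lambda>n x. min 1 (max 0 (real n * (x - a)))"
    have "(\<lambda>n. \<integral>x. t x * ?\<phi> n x \<partial>cheb_measure) = (\<lambda>n. 0)"
      by (intro ext integral_continuous_zero_of_circ_moments[OF t momt, of _ 1]) (auto intro!: continuous_intros)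
    thus "(\<lambda>n. \<integral>x. t x * ?\<phi> n x \<partial>cheb_measure) \<longlonglongrightarrow> 0" by simp
    show "(\<lambda>n. \<integral>x. t x * ?\<phi> n x \<partial>cheb_measure) \<longlonglongrightarrow> (\<integral>x. t x * indicator {a<..} x \<partial>cheb_measure)"
    proof (rule integral_dominated_convergence[where w="\<lambda>x. \<bar>t x\<bar>"])
      show "integrable cheb_measure (\<lambda>x. \<bar>t x\<bar>)" using t by simp
      show "AE x in cheb_measure. (\<lambda>n. t x * ?\<phi> n x) \<longlonglongrightarrow> t x * indicator {a<..} x"
      proof (intro AE_I2 tendsto_intros)
        fix x
        show "(\<lambda>n. ?\<phi> n x) \<longlonglongrightarrow> indicator {a<..} x"
        proof (cases "x > a")
          case True
          obtain N :: nat where "real N * (x - a) > 1"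
            using reals_Archimedean3[of "x - a"] True by auto
          moreover have "real N * (x - a) \<le> real n * (x - a)" if "n \<ge> N" for n
            using that True by (intro mult_right_mono) auto
          ultimately have "real n * (x - a) > 1" if "n \<ge> N" for n
            using that less_le_trans by blast
          hence "?\<phi> n x = 1" if "n \<ge> N" for n
            using that by (fastforce simp: min_def max_def)
          hence "eventually (\<lambda>n. ?\<phi> n x = 1) sequentially" by (auto simp: eventually_sequentially)
          thus ?thesis using True by (simp add: tendsto_eventually)
        next
          case False
          hence "real n * (x - a) \<le> 0" for n by (simp add: mult_nonneg_nonpos)
          hence "?\<phi> n x = 0" for n by (simp add: max_absorb1)
          thus ?thesis using False by simp
        qed
      qed
      show "AE x in cheb_measure. norm (t x * ?\<phi> n x) \<le> \<bar>t x\<bar>" for n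
        by (rule AE_I2) (auto simp: abs_mult intro!: mult_left_le)
    qed simp_all
  qed
  have em: "emeasure (density cheb_measure (\<lambda>x. ennreal (s x))) {a<..} = ennreal (m * measure cheb_measure {a<..})"
    for a
  proof -
    have "emeasure (density cheb_measure (\<lambda>x. ennreal (s x))) {a<..} =
        (\<integral>\<^sup>+x. ennreal (s x * indicator {a<..} x) \<partial>cheb_measure)"
      by (subst emeasure_density) (auto intro!: nn_integral_cong split: split_indicator)
    also have "\<dots> = ennreal (\<integral>x. s x * indicator {a<..} x \<partial>cheb_measure)"
      using s nn by (intro nn_integral_eq_integral integrable_real_mult_indicator) auto
    also have "(\<integral>x. s x * indicator {a<..} x \<partial>cheb_measure) =
      (\<integral>x. t x * indicator {a<..} x + m * indicator {a<..} x \<partial>cheb_measure)"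
      by (simp add: t_def algebra_simps)
    also have "\<dots> = m * measure cheb_measure {a<..}"
      using integrable_real_mult_indicator[OF _ t, of "{a<..}"] ind0[of a]
      by (subst Bochner_Integration.integral_add) (auto simp: less_top[symmetric])
    finally show ?thesis .
  qed
  have "density cheb_measure (\<lambda>x. ennreal (s x)) = density cheb_measure (\<lambda>x. ennreal m)"
  proof (rule measure_eqI_lessThan)
    fix a :: real
    show "emeasure (density cheb_measure (\<lambda>x. ennreal (s x))) {a<..} < \<infinity>" by (simp add: em)
    show "emeasure (density cheb_measure (\<lambda>x. ennreal (s x))) {a<..} = emeasure (density cheb_measure (\<lambda>x. ennreal m)) {a<..}"
      using m by (simp add: em emeasure_density_const cheb.emeasure_eq_measure ennreal_mult)
  qed simp_all
  hence "AE x in cheb_measure. ennreal (s x) = ennreal m"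
    by (subst (asm) cheb.density_unique_iff) auto
  thus ?thesis by eventually_elim (use nn m in \<open>simp add: m_def\<close>)
qed

subsection \<open>Logarithmic integrals\<close>

text \<open>The real part of the power series of the principal logarithm of 1 - y. The term k = 0 is
  0 because dividing by 0 gives 0.\<close>

lemma ln_norm_one_minus_sums:
  fixes y :: complex
  assumes "norm y < 1"
  shows "(\<lambda>k. - Re (y ^ k) / real k) sums ln (norm (1 - y))"
proof -
  have y: "1 - y \<noteq> 0" using assms by auto
  have "(\<lambda>n. (-1) ^ Suc n / of_nat n * (- y) ^ n) sums Ln (1 + - y)"
    using assms by (intro Ln_series) simp
  moreover have "(-1) ^ Suc n / of_nat n * (- y) ^ n = - (y ^ n) / of_nat n" for n
    by (cases "even n") simp_all
  ultimately have "(\<lambda>n. Re (- (y ^ n) / of_nat n)) sums Re (Ln (1 - y))"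
    by (intro sums_Re) (simp only: diff_conv_add_uminus)
  moreover have "Re (- (y ^ n) / of_nat n) = - Re (y ^ n) / real n" for n
    using Re_divide_of_nat[of "- (y ^ n)" n] by simp
  ultimately show ?thesis using y by simp
qed

text \<open>Pairing z with its conjugate gives Re(b^k z^k) + Re(b^k cnj(z)^k) = 2 Re(b^k) Re(z^k),
  so the logarithm becomes a pure cosine series even for non-real b.\<close>

lemma ln_circ_factor_sums:
  assumes b: "norm b < 1"
  shows "(\<lambda>k. - 2 * Re (b ^ k) / real k * Re (circ x ^ k)) sums
    ln (norm ((1 - b * circ x) * (1 - b * cnj (circ x))))"
proof -
  have n: "norm (b * circ x) < 1" "norm (b * cnj (circ x)) < 1"
    using b by (simp_all add: norm_mult)
  hence nz: "1 - b * circ x \<noteq> 0" "1 - b * cnj (circ x) \<noteq> 0" by auto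
  from sums_add[OF ln_norm_one_minus_sums[OF n(1)] ln_norm_one_minus_sums[OF n(2)]]
  have "(\<lambda>k. - Re ((b * circ x) ^ k) / real k + - Re ((b * cnj (circ x)) ^ k) / real k) sums
     ln (norm ((1 - b * circ x) * (1 - b * cnj (circ x))))"
    using nz by (simp add: norm_mult ln_mult)
  moreover have "- Re ((b * circ x) ^ k) / real k + - Re ((b * cnj (circ x)) ^ k) / real k
     = - 2 * Re (b ^ k) / real k * Re (circ x ^ k)" for k
    unfolding power_mult_distrib
    by (simp add: diff_divide_distrib add_divide_distrib flip: complex_cnj_power)
  ultimately show ?thesis by simp
qed

text \<open>Termwise integration of the cosine series, justified by the geometric majorant 2 B
  |b|^k. The bounded weight s covers both uses: s = 1 for Jensen's inequality and s = 1 + cos 2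
  theta for the entropy constant.\<close>

lemma ln_circ_factor_moment_sums:
  fixes s :: "real \<Rightarrow> real"
  assumes b: "norm b < 1" and [measurable]: "s \<in> borel_measurable borel" and B: "\<And>x. \<bar>s x\<bar> \<le> B"
  shows "(\<lambda>k. - 2 * Re (b ^ k) / real k * (\<integral>x. s x * Re (circ x ^ k) \<partial>cheb_measure)) sums
    (\<integral>x. s x * ln (norm ((1 - b * circ x) * (1 - b * cnj (circ x)))) \<partial>cheb_measure)"
proof -
  let ?c = "\<lambda>k. - 2 * Re (b ^ k) / real k"
  let ?f = "\<lambda>k x. s x * (?c k * Re (circ x ^ k))"
  have B0: "B \<ge> 0" using B[of 0] by linarith
  have c: "\<bar>?c k\<bar> \<le> 2 * norm b ^ k" for k
  proof (cases "k = 0")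
    case False
    have "\<bar>?c k\<bar> = 2 * \<bar>Re (b ^ k)\<bar> / real k" by (simp add: abs_mult)
    also have "\<dots> \<le> 2 * \<bar>Re (b ^ k)\<bar> / 1" using False by (intro divide_left_mono) auto
    also have "\<dots> \<le> 2 * norm b ^ k" using abs_Re_le_cmod[of "b ^ k"] by (simp add: norm_power)
    finally show ?thesis .
  qed simp
  have R: "\<bar>Re (circ x ^ k)\<bar> \<le> 1" for x k
    using abs_Re_le_cmod[of "circ x ^ k"] by (simp add: norm_power)
  have f: "norm (?f k x) \<le> B * (2 * norm b ^ k)" for k x
  proof -
    have "norm (?f k x) = \<bar>s x\<bar> * (\<bar>?c k\<bar> * \<bar>Re (circ x ^ k)\<bar>)" by (simp add: abs_mult)
    also have "\<dots> \<le> B * ((2 * norm b ^ k) * 1)"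
      by (intro mult_mono B c R) (use B0 in auto)
    finally show ?thesis by simp
  qed
  have sm: "summable (\<lambda>k. B * (2 * norm b ^ k))"
    using b by (intro summable_mult summable_geometric) auto
  have int: "integrable cheb_measure (?f k)" for k
    using f by (intro cheb.integrable_const_bound[of _ "B * (2 * norm b ^ k)"]) auto
  have "(\<lambda>k. integral\<^sup>L cheb_measure (?f k)) sums (\<integral>x. (\<Sum>k. ?f k x) \<partial>cheb_measure)"
  proof (rule sums_integral[OF int])
    show "AE x in cheb_measure. summable (\<lambda>k. norm (?f k x))"
      using f by (intro AE_I2 summable_comparison_test'[OF sm]) auto
    show "summable (\<lambda>k. \<integral>x. norm (?f k x) \<partial>cheb_measure)"
    proof (rule summable_comparison_test'[OF sm])
      fix k :: nat
      have "(\<integral>x. norm (?f k x) \<partial>cheb_measure) \<le> (\<integral>x. B * (2 * norm b ^ k) \<partial>cheb_measure)"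
        using int f by (intro integral_mono integrable_norm) auto
      thus "norm (\<integral>x. norm (?f k x) \<partial>cheb_measure) \<le> B * (2 * norm b ^ k)" by simp
    qed
  qed
  moreover have "(\<Sum>k. ?f k x) = s x * ln (norm ((1 - b * circ x) * (1 - b * cnj (circ x))))" for x
    using sums_mult[OF ln_circ_factor_sums[OF b, of x], of "s x"] by (simp add: sums_iff)
  moreover have "integral\<^sup>L cheb_measure (?f k) = ?c k * (\<integral>x. s x * Re (circ x ^ k) \<partial>cheb_measure)" for k
  proof -
    have "?f k = (\<lambda>x. ?c k * (s x * Re (circ x ^ k)))" by (simp add: fun_eq_iff)
    thus ?thesis by simp
  qed
  ultimately show ?thesis by (simp only:)
qed

lemma integral_ln_circ_factor:
  assumes "norm b < 1"
  shows "(\<integral>x. ln (norm ((1 - b * circ x) * (1 - b * cnj (circ x)))) \<partial>cheb_measure) = 0"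
proof -
  have "(\<lambda>k. - 2 * Re (b ^ k) / real k * (\<integral>x. 1 * Re (circ x ^ k) \<partial>cheb_measure)) = (\<lambda>k. 0)"
    by (auto simp: integral_Re_circ_power)
  with ln_circ_factor_moment_sums[OF assms, of "\<lambda>_. 1" 1] show ?thesis
    by (simp add: sums_iff)
qed

lemma Re_mult_Re: "Re a * Re c = (Re (a * c) + a \<bullet> c) / 2"
  by (simp add: inner_complex_def)

text \<open>The weight equals 2 x^2 on [-1, 1]. By the product-to-sum formula it selects the single
  frequency k = 2 from a cosine series without constant term.\<close>

lemma integral_Re_circ_square_mult:
  assumes "k \<ge> 1"
  shows "(\<integral>x. (1 + Re (circ x ^ 2)) * Re (circ x ^ k) \<partial>cheb_measure) = (if k = 2 then 1/2 else 0)"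
proof -
  have R: "\<bar>Re (circ x ^ k)\<bar> \<le> 1" for x k
    using abs_Re_le_cmod[of "circ x ^ k"] by (simp add: norm_power)
  have i: "integrable cheb_measure (\<lambda>x. Re (circ x ^ k))" for k
    using R by (intro cheb.integrable_const_bound[of _ 1]) auto
  have "sqint cheb_measure (\<lambda>x. circ x ^ k)" for k
    by (auto intro!: sqint_AE_bounded[of _ _ 1] emeasure_cheb_measure_UNIV simp: norm_power)
  hence j: "integrable cheb_measure (\<lambda>x. circ x ^ 2 \<bullet> circ x ^ k)" by (intro integrable_inner_sqint)
  have "(1 + Re (circ x ^ 2)) * Re (circ x ^ k) =
     Re (circ x ^ k) + (Re (circ x ^ (2 + k)) + circ x ^ 2 \<bullet> circ x ^ k) / 2" for x
    by (simp only: distrib_right mult_1 Re_mult_Re power_add)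
  thus ?thesis using i[of k] i[of "2 + k"] j ip_circ_powers[of 2 k] assms integral_Re_circ_power[of "2 + k"]
      integral_Re_circ_power[of k]
    by (simp add: ip_def del: power_Suc)
qed

text \<open>The factor \<open>1 - b z\<close> with \<open>b = i r\<close> regularises \<open>log (4 x\<^sup>2) = log |1 + z\<^sup>2|\<^sup>2\<close>.\<close>

lemma integral_square_ln_regularized:
  assumes r: "0 \<le> r" "r < 1"
  shows "(\<integral>x. (1 + Re (circ x ^ 2)) * ln ((1 - r\<^sup>2)\<^sup>2 + 4 * r\<^sup>2 * (Re (circ x))\<^sup>2) \<partial>cheb_measure) = r\<^sup>2"
proof -
  let ?b = "\<i> * of_real r"
  let ?s = "\<lambda>x. 1 + Re (circ x ^ 2)"
  have b: "norm ?b < 1" using r by (simp add: norm_mult)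
  have R: "\<bar>Re (circ x ^ 2)\<bar> \<le> 1" for x
    using abs_Re_le_cmod[of "circ x ^ 2"] by (simp add: norm_power)
  have B: "\<bar>?s x\<bar> \<le> 2" for x using R[of x] by linarith
  \<comment> \<open>Since b^2 = -r^2, the surviving term k = 2 is (-2)(-r^2)/2 times 1/2, that is,
    r^2/2. The logarithm of the squared modulus doubles it to r^2.\<close>
  have "(\<lambda>k. - 2 * Re (?b ^ k) / real k * (\<integral>x. ?s x * Re (circ x ^ k) \<partial>cheb_measure))
     = (\<lambda>k. if k = 2 then r\<^sup>2 / 2 else 0)"
  proof
    fix k :: nat
    show "- 2 * Re (?b ^ k) / real k * (\<integral>x. ?s x * Re (circ x ^ k) \<partial>cheb_measure) = (if k = 2 then r\<^sup>2 / 2 else 0)"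
    proof (cases "k = 0")
      case False
      hence "(\<integral>x. ?s x * Re (circ x ^ k) \<partial>cheb_measure) = (if k = 2 then 1/2 else 0)"
        by (intro integral_Re_circ_square_mult) simp
      moreover have "Re (?b ^ 2) = - (r\<^sup>2)" by (simp add: power2_eq_square)
      ultimately show ?thesis by (simp del: power2_eq_iff)
    qed simp
  qed
  moreover have "(\<lambda>k. if k = 2 then r\<^sup>2 / 2 else 0) sums (r\<^sup>2 / 2)" using sums_single[of 2 "\<lambda>_. r\<^sup>2/2"] by simp
  ultimately have *: "(\<integral>x. ?s x * ln (norm ((1 - ?b * circ x) * (1 - ?b * cnj (circ x)))) \<partial>cheb_measure) = r\<^sup>2 / 2"
    using ln_circ_factor_moment_sums[OF b, of ?s 2] B by (auto simp: sums_iff)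
  have "ln ((1 - r\<^sup>2)\<^sup>2 + 4 * r\<^sup>2 * (Re (circ x))\<^sup>2) = 2 * ln (norm ((1 - ?b * circ x) * (1 - ?b * cnj (circ x))))" for x
  proof -
    have "circ x * cnj (circ x) = 1" by (simp add: complex_norm_square[symmetric])
    moreover have "(1 - ?b * circ x) * (1 - ?b * cnj (circ x)) =
      1 - ?b * (circ x + cnj (circ x)) + ?b * ?b * (circ x * cnj (circ x))" by (simp add: algebra_simps)
    moreover have "circ x + cnj (circ x) = 2 * of_real (Re (circ x))" by (simp add: complex_add_cnj)
    ultimately have "(1 - ?b * circ x) * (1 - ?b * cnj (circ x)) = Complex (1 - r\<^sup>2) (- 2 * r * Re (circ x))"
      by (simp add: complex_eq_iff power2_eq_square)
    hence "(norm ((1 - ?b * circ x) * (1 - ?b * cnj (circ x))))\<^sup>2 = (1 - r\<^sup>2)\<^sup>2 + 4 * r\<^sup>2 * (Re (circ x))\<^sup>2"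
      by (simp add: cmod_power2 power_mult_distrib)
    moreover have "1 - ?b * circ x \<noteq> 0" "1 - ?b * cnj (circ x) \<noteq> 0"
    proof -
      have "norm (?b * circ x) < 1" "norm (?b * cnj (circ x)) < 1" using b by (simp_all add: norm_mult)
      thus "1 - ?b * circ x \<noteq> 0" "1 - ?b * cnj (circ x) \<noteq> 0" by auto
    qed
    ultimately show ?thesis by (metis ln_realpow mult_eq_0_iff of_nat_numeral zero_less_norm_iff)
  qed
  hence "(\<integral>x. ?s x * ln ((1 - r\<^sup>2)\<^sup>2 + 4 * r\<^sup>2 * (Re (circ x))\<^sup>2) \<partial>cheb_measure) =
     (\<integral>x. 2 * (?s x * ln (norm ((1 - ?b * circ x) * (1 - ?b * cnj (circ x))))) \<partial>cheb_measure)"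
    by (simp add: mult.left_commute)
  thus ?thesis using * by simp
qed

section \<open>The entropy constant of the arcsine law\<close>

definition xlogx :: "real \<Rightarrow> real" where
  "xlogx t = t\<^sup>2 * ln (t\<^sup>2)"

text \<open>From ln s <= s - 1 at s = 1/|t|. The linear bound yields continuity at 0 and later the
  domination near zeros of x.\<close>

lemma abs_xlogx_le:
  assumes "\<bar>t\<bar> \<le> 1" shows "\<bar>xlogx t\<bar> \<le> 2 * \<bar>t\<bar>"
proof (cases "t = 0")
  case False
  have "ln (1 / \<bar>t\<bar>) \<le> 1 / \<bar>t\<bar>" using False ln_le_minus_one[of "1 / \<bar>t\<bar>"] by simp
  hence 1: "- ln \<bar>t\<bar> \<le> 1 / \<bar>t\<bar>" using False by (simp add: ln_div)
  have 2: "ln (t\<^sup>2) = 2 * ln \<bar>t\<bar>" using False by (metis ln_realpow of_nat_numeral power2_abs zero_less_abs_iff)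
  have 3: "ln \<bar>t\<bar> \<le> 0" using assms False by simp
  have "\<bar>xlogx t\<bar> = t\<^sup>2 * (2 * (- ln \<bar>t\<bar>))" using 2 3 by (simp add: xlogx_def abs_mult)
  also have "\<dots> \<le> t\<^sup>2 * (2 * (1 / \<bar>t\<bar>))" using 1 by (intro mult_left_mono) auto
  also have "\<dots> = 2 * \<bar>t\<bar>" using False by (simp add: field_simps power2_eq_square)
  finally show ?thesis .
qed (simp add: xlogx_def)

lemma continuous_xlogx: "continuous_on UNIV xlogx"
proof (clarsimp simp: continuous_on_eq_continuous_at)
  fix t :: real
  show "isCont xlogx t"
  proof (cases "t = 0")
    case True
    have "(xlogx \<longlongrightarrow> 0) (at 0)"
    proof (rule Lim_null_comparison)
      show "\<forall>\<^sub>F t in at 0. norm (xlogx t) \<le> 2 * \<bar>t\<bar>"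
        unfolding eventually_at by (rule exI[of _ 1]) (auto intro: abs_xlogx_le)
      show "((\<lambda>t. 2 * \<bar>t\<bar>) \<longlongrightarrow> 0) (at (0::real))" by (rule tendsto_eq_intros refl | simp)+
    qed
    thus ?thesis using True by (simp add: isCont_def xlogx_def)
  next
    case False
    thus ?thesis unfolding xlogx_def[abs_def] by (intro continuous_intros) auto
  qed
qed

lemma measurable_xlogx [measurable]: "xlogx \<in> borel_measurable borel"
  by (rule borel_measurable_continuous_onI[OF continuous_xlogx])

text \<open>Write 2 x^2 log(2 x^2) = 2 x^2 log(4 x^2) - 2 x^2 log 2. The first part is the limit of
  the regularised integrals, whose values r^2 tend to 1; the second contributes log 2 because 2 x^2
  has mean 1.\<close>

lemma integral_xlogx_sqrt2:
  "(\<integral>x. xlogx (sqrt 2 * Re (circ x)) \<partial>cheb_measure) = 1 - ln 2"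
proof -
  let ?X = "\<lambda>x. Re (circ x)"
  let ?s = "\<lambda>x. 1 + Re (circ x ^ 2)"
  \<comment> \<open>The shift by 2 keeps r n >= 1/2, so 4 r^2 >= 1 and the regularised argument of
    the logarithm is at least x^2.\<close>
  define r where "r n = 1 - 1 / real (n + 2)" for n
  have r: "1/2 \<le> r n" "r n < 1" for n by (auto simp: r_def field_simps)
  have rlim: "r \<longlonglongrightarrow> 1"
  proof -
    have "(\<lambda>n. 1 / real (n + 2)) \<longlonglongrightarrow> 0"
      using LIMSEQ_ignore_initial_segment[OF lim_1_over_n, of 2] by simp
    from tendsto_diff[OF tendsto_const[of 1] this] show ?thesis by (simp add: r_def[abs_def])
  qed
  have X: "\<bar>?X x\<bar> \<le> 1" for x using abs_Re_le_cmod[of "circ x"] by simp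
  have s: "?s x = 2 * (?X x)\<^sup>2" for x
  proof -
    have "(?X x)\<^sup>2 + (Im (circ x))\<^sup>2 = 1" using cmod_power2[of "circ x"] by simp
    thus ?thesis by (simp add: power2_eq_square)
  qed
  have sX: "integrable cheb_measure ?s" "(\<integral>x. ?s x \<partial>cheb_measure) = 1"
  proof -
    have i: "integrable cheb_measure (\<lambda>x. Re (circ x ^ 2))"
    proof (rule cheb.integrable_const_bound[of _ 1])
      show "AE x in cheb_measure. norm (Re (circ x ^ 2)) \<le> 1"
        using abs_Re_le_cmod[of "circ _ ^ 2"] by (simp add: norm_power)
    qed simp
    thus "integrable cheb_measure ?s" by simp
    show "(\<integral>x. ?s x \<partial>cheb_measure) = 1" using i integral_Re_circ_power[of 2] by simp
  qed
  let ?L = "\<lambda>r x. (1 - r\<^sup>2)\<^sup>2 + 4 * r\<^sup>2 * (?X x)\<^sup>2"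
  have "(\<lambda>n. \<integral>x. ?s x * ln (?L (r n) x) \<partial>cheb_measure) \<longlonglongrightarrow> (\<integral>x. ?s x * ln (4 * (?X x)\<^sup>2) \<partial>cheb_measure)"
  \<comment> \<open>The argument of the logarithm lies between x^2 and 5, hence x^2 |log| <= |x^2
    log x^2| + x^2 log 5 <= 2 + log 5. The factor 2 in the weight 2 x^2 gives the majorant.\<close>
  proof (rule integral_dominated_convergence[where w="\<lambda>x. 4 + 2 * ln 5"])
    show "AE x in cheb_measure. (\<lambda>n. ?s x * ln (?L (r n) x)) \<longlonglongrightarrow> ?s x * ln (4 * (?X x)\<^sup>2)"
    proof (rule AE_I2)
      fix x
      show "(\<lambda>n. ?s x * ln (?L (r n) x)) \<longlonglongrightarrow> ?s x * ln (4 * (?X x)\<^sup>2)"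
      proof (cases "?X x = 0")
        case True
        thus ?thesis unfolding s by simp
      next
        case False
        have "(\<lambda>n. ?L (r n) x) \<longlonglongrightarrow> (1 - 1\<^sup>2)\<^sup>2 + 4 * 1\<^sup>2 * (?X x)\<^sup>2"
          by (intro tendsto_intros rlim)
        hence "(\<lambda>n. ?L (r n) x) \<longlonglongrightarrow> 4 * (?X x)\<^sup>2" by simp
        thus ?thesis using False by (intro tendsto_intros tendsto_ln) auto
      qed
    qed
    fix n
    show "AE x in cheb_measure. norm (?s x * ln (?L (r n) x)) \<le> 4 + 2 * ln 5"
    proof (rule AE_I2)
      fix x
      show "norm (?s x * ln (?L (r n) x)) \<le> 4 + 2 * ln 5"
      proof (cases "?X x = 0")
        case True
        thus ?thesis unfolding s by simp
      next
        case False
        let ?X2 = "(?X x)\<^sup>2"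
        have X2: "0 < ?X2" "?X2 \<le> 1" using False X[of x] by (auto simp: abs_square_le_1)
        have r2: "1/4 \<le> (r n)\<^sup>2" "(r n)\<^sup>2 \<le> 1"
          using power_mono[OF r(1)[of n], of 2] power_mono[OF less_imp_le[OF r(2)[of n]], of 2] r[of n]
          by (auto simp: power2_eq_square)
        have lo: "?X2 \<le> ?L (r n) x"
        proof -
          have "1 * ?X2 \<le> (4 * (r n)\<^sup>2) * ?X2" using r2 X2 by (intro mult_right_mono) auto
          thus ?thesis by (simp add: add_increasing)
        qed
        have hi: "?L (r n) x \<le> 5"
        proof -
          have "(1 - (r n)\<^sup>2)\<^sup>2 \<le> 1" using r2 by (auto simp: abs_square_le_1)
          moreover have "(r n)\<^sup>2 * ?X2 \<le> 1 * 1" using r2 X2 by (intro mult_mono) auto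
          ultimately show ?thesis by linarith
        qed
        have L: "0 < ?L (r n) x" using X2(1) lo by (rule less_le_trans)
        have "ln ?X2 \<le> ln (?L (r n) x)" using ln_le_cancel_iff[OF X2(1) L] lo by simp
        moreover have "ln (?L (r n) x) \<le> ln 5" using ln_le_cancel_iff[OF L] hi by simp
        moreover have "ln ?X2 \<le> 0" using X2 by simp
        moreover have "0 \<le> ln (5::real)" by simp
        ultimately have "\<bar>ln (?L (r n) x)\<bar> \<le> \<bar>ln ?X2\<bar> + ln 5" by linarith
        hence "?X2 * \<bar>ln (?L (r n) x)\<bar> \<le> ?X2 * (\<bar>ln ?X2\<bar> + ln 5)" using X2 by (intro mult_left_mono) auto
        also have "\<dots> = \<bar>xlogx (?X x)\<bar> + ?X2 * ln 5" by (simp add: xlogx_def abs_mult distrib_left)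
        also have "\<dots> \<le> 2 + ln 5"
        proof -
          have "?X2 * ln 5 \<le> 1 * ln 5" using X2 by (intro mult_right_mono) auto
          thus ?thesis using abs_xlogx_le[OF X[of x]] X[of x] by linarith
        qed
        finally show ?thesis unfolding s by (simp add: abs_mult)
      qed
    qed
  qed simp_all
  moreover have "(\<lambda>n. \<integral>x. ?s x * ln (?L (r n) x) \<partial>cheb_measure) \<longlonglongrightarrow> 1"
  proof -
    have "(\<integral>x. ?s x * ln (?L (r n) x) \<partial>cheb_measure) = (r n)\<^sup>2" for n
      using r[of n] by (intro integral_square_ln_regularized) auto
    thus ?thesis using tendsto_power[OF rlim, of 2] by simp
  qed
  ultimately have 1: "(\<integral>x. ?s x * ln (4 * (?X x)\<^sup>2) \<partial>cheb_measure) = 1" using LIMSEQ_unique by blast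
  have eq: "xlogx (sqrt 2 * ?X x) = ?s x * ln (4 * (?X x)\<^sup>2) - ln 2 * ?s x" for x
  proof (cases "?X x = 0")
    case True
    thus ?thesis unfolding s by (simp add: xlogx_def)
  next
    case False
    hence "ln (4 * (?X x)\<^sup>2) = ln (2 * (2 * (?X x)\<^sup>2))" by simp
    also have "\<dots> = ln 2 + ln (2 * (?X x)\<^sup>2)" using False by (subst ln_mult) auto
    finally show ?thesis unfolding s by (simp add: xlogx_def power_mult_distrib algebra_simps)
  qed
  have "integrable cheb_measure (\<lambda>x. xlogx (sqrt 2 * ?X x))"
  proof -
    have "compact (xlogx ` {- sqrt 2..sqrt 2})"
      by (intro compact_continuous_image continuous_on_subset[OF continuous_xlogx]) auto
    then obtain B where B: "\<forall>t\<in>{- sqrt 2..sqrt 2}. \<bar>xlogx t\<bar> \<le> B"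
      using compact_imp_bounded by (fastforce simp: bounded_iff)
    have "\<bar>sqrt 2 * ?X x\<bar> \<le> sqrt 2 * 1" for x unfolding abs_mult using X by (intro mult_mono) auto
    hence "sqrt 2 * ?X x \<in> {- sqrt 2..sqrt 2}" for x by (auto simp: abs_le_iff minus_le_iff)
    thus ?thesis using B by (intro cheb.integrable_const_bound[of _ B]) auto
  qed
  hence "integrable cheb_measure (\<lambda>x. xlogx (sqrt 2 * ?X x) + ln 2 * ?s x)" using sX by simp
  hence "integrable cheb_measure (\<lambda>x. ?s x * ln (4 * (?X x)\<^sup>2))" by (simp add: eq)
  thus ?thesis unfolding eq using sX 1 by simp
qed

subsection \<open>Jensen's inequality and the weighted lower bound\<close>

lemma measurable_cnj_circ [measurable]: "(\<lambda>x. cnj (circ x)) \<in> borel_measurable borel"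
  by (intro borel_measurable_continuous_onI continuous_on_cnj continuous_circ)

lemma integrable_ln_norm_poly_circle:
  fixes q :: "complex poly"
  assumes nz: "\<And>z. norm z = 1 \<Longrightarrow> poly q z \<noteq> 0"
    and [measurable]: "\<zeta> \<in> borel_measurable borel" and \<zeta>: "\<And>x::real. norm (\<zeta> x) = 1"
  shows "integrable cheb_measure (\<lambda>x. ln (norm (poly q (\<zeta> x))))"
proof -
  have "compact ((\<lambda>z. ln (norm (poly q z))) ` sphere 0 1)"
    using nz by (intro compact_continuous_image continuous_intros) auto
  then obtain B where B: "\<forall>z\<in>sphere 0 1. \<bar>ln (norm (poly q z))\<bar> \<le> B"
    using compact_imp_bounded by (fastforce simp: bounded_iff)
  have [measurable]: "poly q \<in> borel_measurable borel"
    by (intro borel_measurable_continuous_onI continuous_intros)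
  show ?thesis using B \<zeta> by (intro cheb.integrable_const_bound[of _ B]) auto
qed

text \<open>A complex root a has no conjugate partner here, so z and its conjugate are summed to
  compensate for the half circle. If |a| > 1, factoring out -a leaves a factor with b = 1/a whose
  log-integral is 0. If |a| < 1, the identity |z - a| = |1 - a cnj z| makes the whole integral 0,
  which is above 2 ln |a|.\<close>

lemma Jensen_linear_circ:
  assumes a: "norm a \<noteq> 1" "a \<noteq> 0"
  shows "2 * ln (norm a) \<le> (\<integral>x. ln (norm (circ x - a)) + ln (norm (cnj (circ x) - a)) \<partial>cheb_measure)"
proof (cases "norm a > 1")
  case True
  define b where "b = 1 / a"
  have b: "norm b < 1" using True unfolding b_def norm_divide
    by (subst divide_less_eq_1_pos) auto
  have "ln (norm (circ x - a)) + ln (norm (cnj (circ x) - a))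
     = 2 * ln (norm a) + ln (norm ((1 - b * circ x) * (1 - b * cnj (circ x))))" for x
  proof -
    have n: "norm (b * circ x) < 1" "norm (b * cnj (circ x)) < 1"
      using b by (simp_all add: norm_mult)
    hence nz: "1 - b * circ x \<noteq> 0" "1 - b * cnj (circ x) \<noteq> 0" by auto
    have "circ x - a = - a * (1 - b * circ x)" "cnj (circ x) - a = - a * (1 - b * cnj (circ x))"
      using a by (simp_all add: b_def field_simps)
    thus ?thesis using nz a by (simp only: norm_mult) (simp add: ln_mult)
  qed
  moreover have "integrable cheb_measure (\<lambda>x. ln (norm ((1 - b * circ x) * (1 - b * cnj (circ x)))))"
  proof -
    have 1: "poly [:1, - b:] z \<noteq> 0" if "norm z = 1" for z
    proof -
      have "norm (b * z) < 1" using b that by (simp add: norm_mult)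
      thus ?thesis by (auto simp: mult.commute)
    qed
    have "integrable cheb_measure (\<lambda>x. ln (norm (poly [:1, - b:] (circ x))) + ln (norm (poly [:1, - b:] (cnj (circ x)))))"
      by (intro Bochner_Integration.integrable_add integrable_ln_norm_poly_circle 1) auto
    moreover have "ln (norm (poly [:1, - b:] (circ x))) + ln (norm (poly [:1, - b:] (cnj (circ x))))
      = ln (norm ((1 - b * circ x) * (1 - b * cnj (circ x))))" for x
      using 1[of "circ x"] 1[of "cnj (circ x)"] by (simp add: norm_mult ln_mult mult.commute)
    ultimately show ?thesis by simp
  qed
  ultimately show ?thesis using integral_ln_circ_factor[OF b] by simp
next
  case False
  hence a1: "norm a < 1" using a by simp
  have "ln (norm (circ x - a)) + ln (norm (cnj (circ x) - a))
     = ln (norm ((1 - a * circ x) * (1 - a * cnj (circ x))))" for x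
  proof -
    have zz: "circ x * cnj (circ x) = 1" by (simp add: complex_norm_square[symmetric])
    have "circ x - a = circ x * (1 - a * cnj (circ x))" "cnj (circ x) - a = cnj (circ x) * (1 - a * circ x)"
      using zz by (simp_all add: algebra_simps)
    hence "norm (circ x - a) = norm (1 - a * cnj (circ x))" "norm (cnj (circ x) - a) = norm (1 - a * circ x)"
      by (simp_all add: norm_mult)
    moreover have n: "norm (a * circ x) < 1" "norm (a * cnj (circ x)) < 1"
      using a1 by (simp_all add: norm_mult)
    hence "1 - a * circ x \<noteq> 0" "1 - a * cnj (circ x) \<noteq> 0" by auto
    ultimately show ?thesis by (simp add: norm_mult ln_mult)
  qed
  hence "(\<integral>x. ln (norm (circ x - a)) + ln (norm (cnj (circ x) - a)) \<partial>cheb_measure) = 0"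
    using integral_ln_circ_factor[OF a1] by simp
  moreover have "ln (norm a) \<le> 0" using a1 a by simp
  ultimately show ?thesis by simp
qed

text \<open>Linear factors are split off by the fundamental theorem of algebra and their
  inequalities added. Since the factors may have non-real coefficients, the induction keeps the sum
  over z and its conjugate.\<close>

lemma Jensen_poly_circ:
  fixes q :: "complex poly"
  assumes "\<And>z. norm z = 1 \<Longrightarrow> poly q z \<noteq> 0" "poly q 0 \<noteq> 0"
  shows "2 * ln (norm (poly q 0)) \<le>
    (\<integral>x. ln (norm (poly q (circ x))) + ln (norm (poly q (cnj (circ x)))) \<partial>cheb_measure)"
  using assms
proof (induction "degree q" arbitrary: q)
  case 0
  then obtain c where "q = [:c:]" using degree_eq_zeroE by metis
  thus ?case by simp
next
  case (Suc n)
  have "\<not> constant (poly q)" using Suc(2) by (simp add: constant_degree)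
  then obtain a where a: "poly q a = 0" using fundamental_theorem_of_algebra by blast
  then obtain r where r: "q = [:-a, 1:] * r" by (metis dvdE poly_eq_0_iff_dvd)
  have pq: "poly q z = (z - a) * poly r z" for z by (simp add: r algebra_simps)
  have rn: "r \<noteq> 0" using Suc(2) r by auto
  hence "degree q = Suc (degree r)" unfolding r by (subst degree_mult_eq) auto
  hence dr: "n = degree r" using Suc(2) by simp
  have nzr: "poly r z \<noteq> 0" if "norm z = 1" for z using Suc(3)[OF that] by (auto simp: pq)
  have r0: "poly r 0 \<noteq> 0" using Suc(4) by (auto simp: pq)
  have an: "norm a \<noteq> 1" "a \<noteq> 0" using Suc(3)[of a] Suc(4) a by auto
  hence nza: "poly [:- a, 1:] z \<noteq> 0" if "norm z = 1" for z using that by auto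
  have ne: "circ x \<noteq> a" "cnj (circ x) \<noteq> a" for x using an by (metis norm_circ, metis complex_mod_cnj norm_circ)
  have i1: "integrable cheb_measure (\<lambda>x. ln (norm (circ x - a)) + ln (norm (cnj (circ x) - a)))"
    using integrable_ln_norm_poly_circle[OF nza, of circ] integrable_ln_norm_poly_circle[OF nza, of "\<lambda>x. cnj (circ x)"]
    by simp
  have i2: "integrable cheb_measure (\<lambda>x. ln (norm (poly r (circ x))) + ln (norm (poly r (cnj (circ x)))))"
    using integrable_ln_norm_poly_circle[OF nzr, of circ] integrable_ln_norm_poly_circle[OF nzr, of "\<lambda>x. cnj (circ x)"]
    by simp
  have "2 * ln (norm (poly q 0)) = 2 * ln (norm a) + 2 * ln (norm (poly r 0))"
    using an r0 by (simp add: pq norm_mult ln_mult)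
  also have "\<dots> \<le> (\<integral>x. ln (norm (circ x - a)) + ln (norm (cnj (circ x) - a)) \<partial>cheb_measure)
    + (\<integral>x. ln (norm (poly r (circ x))) + ln (norm (poly r (cnj (circ x)))) \<partial>cheb_measure)"
    using Suc(1)[OF dr nzr r0] Jensen_linear_circ[OF an] by (intro add_mono) auto
  also have "\<dots> = (\<integral>x. (ln (norm (circ x - a)) + ln (norm (cnj (circ x) - a)))
      + (ln (norm (poly r (circ x))) + ln (norm (poly r (cnj (circ x))))) \<partial>cheb_measure)"
    using i1 i2 by (rule Bochner_Integration.integral_add[symmetric])
  also have "\<dots> = (\<integral>x. ln (norm (poly q (circ x))) + ln (norm (poly q (cnj (circ x)))) \<partial>cheb_measure)"
  proof (rule Bochner_Integration.integral_cong)
    fix x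
    show "ln (norm (circ x - a)) + ln (norm (cnj (circ x) - a)) + (ln (norm (poly r (circ x))) + ln (norm (poly r (cnj (circ x)))))
      = ln (norm (poly q (circ x))) + ln (norm (poly q (cnj (circ x))))"
      using ne[of x] nzr[of "circ x"] nzr[of "cnj (circ x)"] by (simp add: pq norm_mult ln_mult)
  qed simp
  finally show ?case .
qed

section \<open>Real polynomials on the circle and lower bounds for their weighted norms\<close>

abbreviation cpoly :: "real poly \<Rightarrow> complex \<Rightarrow> complex" where
  "cpoly h \<equiv> poly (map_poly complex_of_real h)"

lemma cpoly_pCons [simp]: "cpoly (pCons a h) z = of_real a + z * cpoly h z"
  by (simp add: map_poly_pCons)

lemma cpoly_1 [simp]: "cpoly 1 z = 1"
  unfolding one_pCons by (simp del: one_poly_eq_simps)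

lemma cpoly_add [simp]: "cpoly (h + g) z = cpoly h z + cpoly g z"
proof -
  have "map_poly complex_of_real (h + g) = map_poly of_real h + map_poly of_real g"
    by (intro poly_eqI) (simp add: coeff_map_poly)
  thus ?thesis by simp
qed

lemma cpoly_smult [simp]: "cpoly (smult c h) z = of_real c * cpoly h z"
proof -
  have "map_poly complex_of_real (smult c h) = smult (of_real c) (map_poly of_real h)"
    by (intro poly_eqI) (simp add: coeff_map_poly)
  thus ?thesis by simp
qed

lemma cpoly_diff [simp]: "cpoly (h - g) z = cpoly h z - cpoly g z"
  using cpoly_add[of "h - g" g z] by simp

lemma cpoly_mult [simp]: "cpoly (h * g) z = cpoly h z * cpoly g z"
  by (induction h) (simp_all add: algebra_simps)

lemma cpoly_monom [simp]: "cpoly (monom c n) z = of_real c * z ^ n"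
  by (induction n) (simp_all add: monom_Suc monom_0)

lemma cpoly_cnj: "cpoly h (cnj z) = cnj (cpoly h z)"
  by (induction h) simp_all

lemma cpoly_zero_arg: "cpoly h 0 = of_real (poly h 0)"
  by (induction h) simp_all

lemma measurable_cpoly [measurable]: "cpoly h \<in> borel_measurable borel"
  by (intro borel_measurable_continuous_onI continuous_intros)

text \<open>Integrate 1 + y <= exp y for y = 2 ln |q| + ln v - c, where c is the mean of ln v. By
  Jensen's inequality y has nonnegative mean.\<close>

lemma weighted_norm_lower_bound_no_circle_zeros:
  fixes v :: "real \<Rightarrow> real"
  assumes v: "integrable cheb_measure v" "AE x in cheb_measure. v x > 0"
    and lnv: "integrable cheb_measure (\<lambda>x. ln (v x))"
    and nz: "\<And>z. norm z = 1 \<Longrightarrow> poly q z \<noteq> 0" and q0: "poly q 0 = 1"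
    and cnj: "\<And>z. poly q (cnj z) = cnj (poly q z)"
  shows "exp (\<integral>x. ln (v x) \<partial>cheb_measure) \<le> (\<integral>x. (norm (poly q (circ x)))\<^sup>2 * v x \<partial>cheb_measure)"
proof -
  let ?N = "\<lambda>x. norm (poly q (circ x))"
  define c where "c = (\<integral>x. ln (v x) \<partial>cheb_measure)"
  have [measurable]: "poly q \<in> borel_measurable borel"
    by (intro borel_measurable_continuous_onI continuous_intros)
  have iN: "integrable cheb_measure (\<lambda>x. ln (?N x))"
    by (intro integrable_ln_norm_poly_circle nz) auto
  have "2 * ln (norm (poly q 0)) \<le> (\<integral>x. ln (?N x) + ln (norm (poly q (cnj (circ x)))) \<partial>cheb_measure)"
    using nz q0 by (intro Jensen_poly_circ) auto
  \<comment> \<open>Conjugation symmetry makes the two logarithms equal, so the bound 2 ln |q(0)| =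
    0 passes to the integral of ln |q(z)| alone.\<close>
  hence J: "0 \<le> (\<integral>x. ln (?N x) \<partial>cheb_measure)" using q0 by (simp add: cnj)
  have "compact ((\<lambda>z. (norm (poly q z))\<^sup>2) ` sphere 0 1)"
    by (intro compact_continuous_image continuous_intros) auto
  then obtain B where B: "\<forall>z\<in>sphere 0 1. \<bar>(norm (poly q z))\<^sup>2\<bar> \<le> B"
    using compact_imp_bounded by (fastforce simp: bounded_iff)
  have iv: "integrable cheb_measure (\<lambda>x. (?N x)\<^sup>2 * v x)"
    using integrable_mult_AE_bounded[OF v(1), of "\<lambda>x. (?N x)\<^sup>2" B] B by (simp add: mult.commute)
  have "1 \<le> (\<integral>x. 1 + (2 * ln (?N x) + ln (v x) - c) \<partial>cheb_measure)"
    using iN lnv J by (simp add: c_def)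
  also have "\<dots> \<le> (\<integral>x. (?N x)\<^sup>2 * v x * exp (- c) \<partial>cheb_measure)"
  proof (rule integral_mono_AE)
    show "AE x in cheb_measure. 1 + (2 * ln (?N x) + ln (v x) - c) \<le> (?N x)\<^sup>2 * v x * exp (- c)"
      using v(2)
    proof eventually_elim
      case (elim x)
      have N: "?N x > 0" using nz by simp
      have "ln ((?N x)\<^sup>2 * v x * exp (- c)) = 2 * ln (?N x) + ln (v x) - c"
        using N elim by (simp add: ln_mult ln_realpow)
      moreover have "ln ((?N x)\<^sup>2 * v x * exp (- c)) \<le> (?N x)\<^sup>2 * v x * exp (- c) - 1"
        using N elim by (intro ln_le_minus_one) auto
      ultimately show ?case by linarith
    qed
  qed (use iN lnv iv in auto)
  also have "\<dots> = (\<integral>x. (?N x)\<^sup>2 * v x \<partial>cheb_measure) * exp (- c)" by simp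
  finally show ?thesis by (simp add: c_def exp_minus field_simps)
qed

text \<open>Zeros of \<open>h\<close> on the unit circle are avoided by passing to \<open>h(rz)\<close> and letting \<open>r\<close> tend to \<open>1\<close>.\<close>

lemma weighted_norm_lower_bound:
  fixes v :: "real \<Rightarrow> real"
  assumes v: "integrable cheb_measure v" "AE x in cheb_measure. v x > 0"
    and lnv: "integrable cheb_measure (\<lambda>x. ln (v x))"
    and h0: "poly h 0 = 1"
  shows "exp (\<integral>x. ln (v x) \<partial>cheb_measure) \<le> (\<integral>x. (norm (cpoly h (circ x)))\<^sup>2 * v x \<partial>cheb_measure)"
proof -
  define r where "r n = 1 - 1 / real (n + 2)" for n
  have r: "0 < r n" "r n < 1" for n by (auto simp: r_def field_simps)
  have rlim: "r \<longlonglongrightarrow> 1"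
  proof -
    have "(\<lambda>n. 1 / real (n + 2)) \<longlonglongrightarrow> 0"
      using LIMSEQ_ignore_initial_segment[OF lim_1_over_n, of 2] by simp
    from tendsto_diff[OF tendsto_const[of 1] this] show ?thesis by (simp add: r_def[abs_def])
  qed
  have [measurable]: "v \<in> borel_measurable borel" using borel_measurable_integrable[OF v(1)] by simp
  have "map_poly complex_of_real h \<noteq> 0" using cpoly_zero_arg[of h] h0 by auto
  hence "finite {z. cpoly h z = 0}" by (rule poly_roots_finite)
  \<comment> \<open>As r is injective and h has finitely many zeros, only finitely many n have a
    zero of h on the circle of radius r n.\<close>
  hence "finite (r -` (norm ` {z. cpoly h z = 0}))"
    by (intro finite_vimageI) (auto simp: inj_on_def r_def)
  hence ev: "eventually (\<lambda>n. r n \<notin> norm ` {z. cpoly h z = 0}) sequentially"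
    unfolding cofinite_eq_sequentially[symmetric] eventually_cofinite by (simp add: vimage_def)
  have le: "eventually (\<lambda>n. exp (\<integral>x. ln (v x) \<partial>cheb_measure) \<le>
      (\<integral>x. (norm (cpoly h (of_real (r n) * circ x)))\<^sup>2 * v x \<partial>cheb_measure)) sequentially"
    using ev
  proof eventually_elim
    case (elim n)
    define q where "q = pcompose (map_poly complex_of_real h) [:0, of_real (r n):]"
    have q: "poly q z = cpoly h (of_real (r n) * z)" for z
      by (simp add: q_def poly_pcompose mult.commute)
    have "poly q z \<noteq> 0" if "norm z = 1" for z
    proof
      assume "poly q z = 0"
      moreover have "norm (of_real (r n) * z) = r n" using that r[of n] by (simp add: norm_mult)
      ultimately show False using elim unfolding q by (metis (mono_tags) imageI mem_Collect_eq)
    qed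
    moreover have "poly q 0 = 1" using h0 by (simp add: q cpoly_zero_arg)
    moreover have "poly q (cnj z) = cnj (poly q z)" for z
      using cpoly_cnj[of h "of_real (r n) * z"] by (simp add: q)
    ultimately show ?case using weighted_norm_lower_bound_no_circle_zeros[OF v lnv, of q] by (simp add: q)
  qed
  have lim: "(\<lambda>n. \<integral>x. (norm (cpoly h (of_real (r n) * circ x)))\<^sup>2 * v x \<partial>cheb_measure)
     \<longlonglongrightarrow> (\<integral>x. (norm (cpoly h (circ x)))\<^sup>2 * v x \<partial>cheb_measure)"
  proof -
    have "compact ((\<lambda>z. (norm (cpoly h z))\<^sup>2) ` cball 0 1)"
      by (intro compact_continuous_image continuous_intros) auto
    then obtain B where B: "\<forall>z\<in>cball 0 1. \<bar>(norm (cpoly h z))\<^sup>2\<bar> \<le> B"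
      using compact_imp_bounded by (fastforce simp: bounded_iff)
    show ?thesis
    proof (rule integral_dominated_convergence[where w="\<lambda>x. B * \<bar>v x\<bar>"])
      show "AE x in cheb_measure. (\<lambda>n. (norm (cpoly h (of_real (r n) * circ x)))\<^sup>2 * v x) \<longlonglongrightarrow> (norm (cpoly h (circ x)))\<^sup>2 * v x"
      proof (rule AE_I2)
        fix x
        have "(\<lambda>n. of_real (r n) * circ x) \<longlonglongrightarrow> of_real 1 * circ x" by (intro tendsto_intros rlim)
        hence "(\<lambda>n. cpoly h (of_real (r n) * circ x)) \<longlonglongrightarrow> cpoly h (of_real 1 * circ x)"
          by (rule isCont_tendsto_compose[OF poly_isCont])
        thus "(\<lambda>n. (norm (cpoly h (of_real (r n) * circ x)))\<^sup>2 * v x) \<longlonglongrightarrow> (norm (cpoly h (circ x)))\<^sup>2 * v x"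
          by (intro tendsto_mult[OF tendsto_power[OF tendsto_norm] tendsto_const]) simp
      qed
      fix n
      show "AE x in cheb_measure. norm ((norm (cpoly h (of_real (r n) * circ x)))\<^sup>2 * v x) \<le> B * \<bar>v x\<bar>"
      proof (rule AE_I2)
        fix x
        have "of_real (r n) * circ x \<in> cball 0 1" using r[of n] by (simp add: norm_mult)
        hence "(norm (cpoly h (of_real (r n) * circ x)))\<^sup>2 \<le> B" using B by force
        thus "norm ((norm (cpoly h (of_real (r n) * circ x)))\<^sup>2 * v x) \<le> B * \<bar>v x\<bar>"
          by (simp add: abs_mult mult_right_mono)
      qed
    qed (use v in \<open>auto simp: integrable_abs\<close>)
  qed
  show ?thesis by (rule tendsto_lowerbound[OF lim le]) simp
qed

subsection \<open>The extremal function\<close>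

text \<open>On the circle z Re z = (z^2 + 1)/2, so each power of x absorbs one factor z at the cost
  of (1 + z^2)/2. Only the coefficient of x^n reaches the constant term, and it is halved n times.
  Thus z^n p_n becomes a multiple of a competitor.\<close>

lemma poly_Re_mult_power_eq_cpoly:
  assumes "degree q \<le> n"
  shows "\<exists>Q. poly Q 0 = coeff q n / 2 ^ n \<and>
    (\<forall>y. norm y = 1 \<longrightarrow> y ^ n * of_real (poly q (Re y)) = cpoly Q y)"
  using assms
proof (induction n arbitrary: q)
  case 0
  then obtain a where "q = [:a:]" using degree_eq_zeroE by auto
  thus ?case by (intro exI[of _ q]) simp
next
  case (Suc n)
  obtain a q' where q: "q = pCons a q'" by (cases q)
  have "degree q' \<le> n" using Suc(2) by (cases "q' = 0") (auto simp: q)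
  from Suc(1)[OF this] obtain Q where Q: "poly Q 0 = coeff q' n / 2 ^ n"
    "\<And>y. norm y = 1 \<Longrightarrow> y ^ n * of_real (poly q' (Re y)) = cpoly Q y" by blast
  let ?Q = "monom a (Suc n) + [:1/2, 0, 1/2:] * Q"
  have "poly ?Q 0 = coeff q (Suc n) / 2 ^ Suc n" using Q(1) by (simp add: q poly_monom)
  moreover have "y ^ Suc n * of_real (poly q (Re y)) = cpoly ?Q y" if y: "norm y = 1" for y
  proof -
    have "y * cnj y = 1" using y by (simp add: complex_norm_square[symmetric])
    moreover have "complex_of_real (Re y) = (y + cnj y) / 2" by (simp add: complex_add_cnj)
    ultimately have yR: "y * of_real (Re y) = (y * y + 1) / 2" by (simp add: algebra_simps)
    have "y ^ Suc n * of_real (poly q (Re y)) =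
      of_real a * y ^ Suc n + (y * of_real (Re y)) * (y ^ n * of_real (poly q' (Re y)))"
      by (simp add: q algebra_simps)
    also have "\<dots> = of_real a * y ^ Suc n + (y * y + 1) / 2 * cpoly Q y"
      unfolding yR Q(2)[OF y] ..
    also have "\<dots> = cpoly ?Q y" by (simp add: algebra_simps)
    finally show ?thesis .
  qed
  ultimately show ?case by blast
qed

text \<open>The polynomial is the sum of 2 h_k T_(n-k). Because degree h < n, every index n - k is
  at least 1. The top term 2 h_0 T_n has leading coefficient 2 * 2^(n-1) h_0, and T_0 with its
  exceptional leading coefficient never occurs.\<close>

lemma inner_power_cpoly_eq_poly_Re:
  assumes "degree h < n"
  shows "\<exists>P. degree P \<le> n \<and> coeff P n = 2 ^ n * coeff h 0 \<and>
    (\<forall>y. norm y = 1 \<longrightarrow> poly P (Re y) = 2 * (y ^ n \<bullet> cpoly h y))"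
  using assms
proof (induction h arbitrary: n)
  case 0
  show ?case by (intro exI[of _ 0]) simp
next
  case (pCons a h)
  obtain n' where n: "n = Suc n'" using pCons.prems by (cases n) auto
  have T: "degree (chebT n) = n" "coeff (chebT n) n = 2 ^ n'"
    using degree_lead_coeff_chebT[of n] n by auto
  have inn: "y ^ n \<bullet> complex_of_real a = a * Re (y ^ n)" for y by (simp add: inner_complex_def)
  \<comment> \<open>The case h = 0 is separate because for n = 1 the induction hypothesis would
    demand degree h < 0.\<close>
  show ?case
  proof (cases "h = 0")
    case True
    show ?thesis
      by (intro exI[of _ "smult (2 * a) (chebT n)"])
        (use T True inn in \<open>auto simp: n poly_chebT_Re power_Suc[of "2::real" n'] simp del: power_Suc intro: order_trans[OF degree_smult_le]\<close>)
  next
    case False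
    hence "degree h < n'" using pCons.prems by (simp add: n)
    from pCons.IH[OF this] obtain P where P: "degree P \<le> n'"
      "\<And>y. norm y = 1 \<Longrightarrow> poly P (Re y) = 2 * (y ^ n' \<bullet> cpoly h y)" by blast
    let ?P = "smult (2 * a) (chebT n) + P"
    have "degree ?P \<le> n"
      using P(1) T n by (intro degree_add_le) (auto intro: order_trans[OF degree_smult_le])
    moreover have "coeff ?P n = 2 ^ n * coeff (pCons a h) 0"
      using P(1) T n by (simp add: coeff_eq_0)
    moreover have "poly ?P (Re y) = 2 * (y ^ n \<bullet> cpoly (pCons a h) y)" if y: "norm y = 1" for y
    proof -
      have "y ^ n \<bullet> (y * cpoly h y) = Re (y * y ^ n' * cnj (y * cpoly h y))"
        by (simp only: Re_mult_cnj n power_Suc)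
      also have "y * y ^ n' * cnj (y * cpoly h y) = (y * cnj y) * (y ^ n' * cnj (cpoly h y))" by simp
      also have "y * cnj y = 1" using y by (simp add: complex_norm_square[symmetric])
      finally have "y ^ n \<bullet> (y * cpoly h y) = y ^ n' \<bullet> cpoly h y" by (simp only: mult_1 Re_mult_cnj)
      thus ?thesis using P(2)[OF y] inn[of y] poly_chebT_Re[OF y, of n] by (simp add: inner_add_right)
    qed
    ultimately show ?thesis by blast
  qed
qed

lemma sqint_weighted_cpoly:
  assumes v: "integrable cheb_measure v" and nn: "\<And>x. 0 \<le> v x"
  shows "sqint cheb_measure (\<lambda>x. sqrt (v x) *\<^sub>R cpoly h (circ x))"
    "ip cheb_measure (\<lambda>x. sqrt (v x) *\<^sub>R cpoly h (circ x)) (\<lambda>x. sqrt (v x) *\<^sub>R cpoly h (circ x))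
      = (\<integral>x. (norm (cpoly h (circ x)))\<^sup>2 * v x \<partial>cheb_measure)"
proof -
  have [measurable]: "v \<in> borel_measurable borel" using borel_measurable_integrable[OF v] by simp
  have eq: "(norm (sqrt (v x) *\<^sub>R cpoly h (circ x)))\<^sup>2 = v x * (norm (cpoly h (circ x)))\<^sup>2" for x
    using nn by (simp add: power_mult_distrib)
  have "compact ((\<lambda>z. (norm (cpoly h z))\<^sup>2) ` sphere 0 1)"
    by (intro compact_continuous_image continuous_intros) auto
  then obtain B where B: "\<forall>z\<in>sphere 0 1. \<bar>(norm (cpoly h z))\<^sup>2\<bar> \<le> B"
    using compact_imp_bounded by (fastforce simp: bounded_iff)
  hence "integrable cheb_measure (\<lambda>x. v x * (norm (cpoly h (circ x)))\<^sup>2)"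
    by (intro integrable_mult_AE_bounded[OF v, of _ B]) auto
  thus "sqint cheb_measure (\<lambda>x. sqrt (v x) *\<^sub>R cpoly h (circ x))" unfolding sqint_def eq by simp
  show "ip cheb_measure (\<lambda>x. sqrt (v x) *\<^sub>R cpoly h (circ x)) (\<lambda>x. sqrt (v x) *\<^sub>R cpoly h (circ x))
      = (\<integral>x. (norm (cpoly h (circ x)))\<^sup>2 * v x \<partial>cheb_measure)"
    unfolding ip_self eq by (simp add: mult.commute)
qed

lemma AE_Re_circ: "AE x in cheb_measure. Re (circ x) = x"
  using AE_cheb_measure_interior by eventually_elim (simp add: Re_circ)

text \<open>The polynomials \<open>h k\<close> are part of the conclusion because \<open>u\<close>
  is only a limit of admissible functions, whereas the later comparison requires actual polynomials.
  The constant m is the squared norm of \<open>u\<close>.\<close>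

lemma szego_extremal_function:
  assumes v: "integrable cheb_measure v" "AE x in cheb_measure. v x > 0" and nn: "\<And>x. 0 \<le> v x"
    and lnv: "integrable cheb_measure (\<lambda>x. ln (v x))"
  obtains u U h m where "sqint cheb_measure u" "m > 0"
    "U \<in> borel_measurable borel" "\<And>x. norm (U x) = 1" "AE x in cheb_measure. u x = sqrt m *\<^sub>R U x"
    "\<And>k. poly (h k) 0 = 1"
    "(\<lambda>k. ip cheb_measure (\<lambda>x. sqrt (v x) *\<^sub>R cpoly (h k) (circ x) - u x)
        (\<lambda>x. sqrt (v x) *\<^sub>R cpoly (h k) (circ x) - u x)) \<longlonglongrightarrow> 0"
    "\<And>g. poly g 0 = 1 \<Longrightarrow> ip cheb_measure u (\<lambda>x. sqrt (v x) *\<^sub>R cpoly g (circ x)) = m"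
proof -
  let ?\<mu> = cheb_measure
  let ?W = "\<lambda>h x. sqrt (v x) *\<^sub>R cpoly h (circ x)"
  define S where "S = {?W h |h. poly h 0 = 1}"
  define c where "c = exp (\<integral>x. ln (v x) \<partial>?\<mu>)"
  have sW: "sqint ?\<mu> (?W h)" for h by (rule sqint_weighted_cpoly[OF v(1) nn])
  have S1: "sqint ?\<mu> f" if "f \<in> S" for f using that sW by (auto simp: S_def)
  have "?W 1 \<in> S" unfolding S_def by (rule CollectI, rule exI[of _ 1]) simp
  hence S2: "S \<noteq> {}" by blast
  have S3: "(\<lambda>x. f x + t *\<^sub>R (g x - f x)) \<in> S" if fg: "f \<in> S" "g \<in> S" for f g t
  proof -
    obtain a b where ab: "f = ?W a" "g = ?W b" "poly a 0 = 1" "poly b 0 = 1" using fg by (auto simp: S_def)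
    have "(\<lambda>x. f x + t *\<^sub>R (g x - f x)) = ?W (a + smult t (b - a))"
      by (auto simp: ab fun_eq_iff scaleR_conv_of_real algebra_simps)
    moreover have "poly (a + smult t (b - a)) 0 = 1" using ab by simp
    ultimately show ?thesis unfolding S_def by blast
  qed
  have S4: "c \<le> ip ?\<mu> f f" if "f \<in> S" for f
    using that weighted_norm_lower_bound[OF v lnv]
    by (auto simp: S_def c_def sqint_weighted_cpoly(2)[OF v(1) nn])
  obtain u F where u: "sqint ?\<mu> u" and F: "\<And>k. F k \<in> S"
    and Fu: "(\<lambda>k. ip ?\<mu> (\<lambda>x. F k x - u x) (\<lambda>x. F k x - u x)) \<longlonglongrightarrow> 0"
    and cu: "c \<le> ip ?\<mu> u u" and ug: "\<And>g. g \<in> S \<Longrightarrow> ip ?\<mu> u g = ip ?\<mu> u u"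
    using affine_minimizer[of ?\<mu> S c, OF emeasure_cheb_measure_UNIV S1 S2 S3 S4] by blast
  have [measurable]: "u \<in> borel_measurable borel" using sqint_measurable[OF u] by simp
  have "\<forall>k. \<exists>h. F k = ?W h \<and> poly h 0 = 1" using F by (auto simp: S_def)
  then obtain h where h: "\<And>k. F k = ?W (h k)" "\<And>k. poly (h k) 0 = 1" by metis
  define m where "m = ip ?\<mu> u u"
  have m: "m > 0" using cu by (auto simp: m_def c_def intro: less_le_trans[OF exp_gt_zero])
  have g: "ip ?\<mu> u (?W g) = m" if "poly g 0 = 1" for g
    unfolding m_def by (rule ug) (use that in \<open>auto simp: S_def\<close>)
  have mom: "(\<integral>x. (norm (u x))\<^sup>2 * Re (circ x ^ j) \<partial>?\<mu>) = 0" if j: "j \<ge> 1" for j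
  proof -
    let ?c = "\<lambda>x. circ x ^ j"
    have cb: "norm (?c x) \<le> 1" for x by (simp add: norm_power)
    have [measurable]: "?c \<in> borel_measurable ?\<mu>" by simp
    have sc: "sqint ?\<mu> (\<lambda>x. ?c x * f x)" if "sqint ?\<mu> f" for f
      by (rule sqint_mult_bounded(1)[OF that _ cb]) simp
    have "ip ?\<mu> (\<lambda>x. ?c x * F k x) u = 0" for k
    proof -
      \<comment> \<open>The factor 1 + z^j leaves the value at 0 unchanged since j >= 1, so (1 +
        z^j) h_k is again a competitor. Comparing its product with u to that of h_k isolates the
        product of z^j F_k with u, which must be 0.\<close>
      have "poly ((1 + monom 1 j) * h k) 0 = 1" using h(2)[of k] j by (simp add: poly_monom)
      hence "m = ip ?\<mu> u (?W ((1 + monom 1 j) * h k))" using g by metis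
      also have "?W ((1 + monom 1 j) * h k) = (\<lambda>x. F k x + ?c x * F k x)"
        by (auto simp: fun_eq_iff h(1) scaleR_conv_of_real algebra_simps)
      also have "ip ?\<mu> u \<dots> = ip ?\<mu> u (F k) + ip ?\<mu> u (\<lambda>x. ?c x * F k x)"
        using u S1[OF F] sqint_mult_bounded(1)[OF S1[OF F] _ cb] by (intro ip_add_right) auto
      also have "ip ?\<mu> u (F k) = m" unfolding h(1) by (rule g[OF h(2)])
      finally show ?thesis by (simp add: ip_commute)
    qed
    moreover have "(\<lambda>k. ip ?\<mu> (\<lambda>x. ?c x * F k x) u) \<longlonglongrightarrow> ip ?\<mu> (\<lambda>x. ?c x * u x) u"
    proof (rule tendsto_ip_const_right)
      show "(\<lambda>k. ip ?\<mu> (\<lambda>x. ?c x * F k x - ?c x * u x) (\<lambda>x. ?c x * F k x - ?c x * u x)) \<longlonglongrightarrow> 0"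
      proof (rule tendsto_sandwich[OF _ _ tendsto_const Fu])
        show "\<forall>\<^sub>F k in sequentially. ip ?\<mu> (\<lambda>x. ?c x * F k x - ?c x * u x) (\<lambda>x. ?c x * F k x - ?c x * u x)
           \<le> ip ?\<mu> (\<lambda>x. F k x - u x) (\<lambda>x. F k x - u x)"
          using sqint_mult_bounded(2)[OF sqint_diff[OF S1[OF F] u] _ cb]
          by (intro always_eventually allI) (simp add: right_diff_distrib)
      qed (simp add: ip_self_nonneg)
    qed (use u S1[OF F] sc in auto)
    ultimately have "ip ?\<mu> (\<lambda>x. ?c x * u x) u = 0" by (simp add: LIMSEQ_const_iff)
    moreover have "(?c x * u x) \<bullet> u x = (norm (u x))\<^sup>2 * Re (?c x)" for x
    proof -
      have "(?c x * u x) \<bullet> u x = Re (?c x * (u x * cnj (u x)))"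
        unfolding Re_mult_cnj[symmetric] by (simp only: mult.assoc)
      also have "u x * cnj (u x) = of_real ((norm (u x))\<^sup>2)" by (rule complex_norm_square[symmetric])
      finally show ?thesis by (simp del: of_real_power)
    qed
    ultimately show ?thesis by (simp add: ip_def)
  qed
  have "AE x in ?\<mu>. (norm (u x))\<^sup>2 = (\<integral>x. (norm (u x))\<^sup>2 \<partial>?\<mu>)"
    using u mom by (intro AE_const_of_circ_moments) (auto simp: sqint_def)
  hence um: "AE x in ?\<mu>. (norm (u x))\<^sup>2 = m" by (simp add: m_def ip_self)
  \<comment> \<open>The value 1 on the exceptional null set makes \<open>U\<close> unimodular
    everywhere, so later bounds hold pointwise.\<close>
  define U where "U x = (if (norm (u x))\<^sup>2 = m then (1 / sqrt m) *\<^sub>R u x else 1)" for x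
  have Um: "U \<in> borel_measurable borel" unfolding U_def[abs_def] by measurable
  have U1: "norm (U x) = 1" for x
  proof (cases "(norm (u x))\<^sup>2 = m")
    case True
    hence "norm (u x) = sqrt m" by (metis norm_ge_zero real_sqrt_unique)
    thus ?thesis using True m by (simp add: U_def)
  qed (simp add: U_def)
  have "AE x in ?\<mu>. u x = sqrt m *\<^sub>R U x" using um by eventually_elim (use m in \<open>simp add: U_def\<close>)
  from that[OF u m Um U1 this h(2) Fu[unfolded h(1)] g] show ?thesis by blast
qed

lemma sqint_weighted_poly:
  assumes v: "integrable cheb_measure v" and nn: "\<And>x. 0 \<le> v x"
  shows "sqint cheb_measure (\<lambda>x. poly q x * sqrt (v x))"
proof -
  have [measurable]: "v \<in> borel_measurable borel" using borel_measurable_integrable[OF v] by simp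
  obtain B where B: "\<forall>x\<in>{-1..1}. \<bar>poly (q * q) x\<bar> \<le> B" using poly_bounded_Icc by blast
  have "AE x in cheb_measure. \<bar>(poly q x)\<^sup>2\<bar> \<le> B"
    using AE_cheb_measure_interior by eventually_elim (use B in \<open>auto simp: power2_eq_square abs_less_iff\<close>)
  hence "integrable cheb_measure (\<lambda>x. v x * (poly q x)\<^sup>2)"
    by (intro integrable_mult_AE_bounded[OF v]) auto
  moreover have "(norm (poly q x * sqrt (v x)))\<^sup>2 = v x * (poly q x)\<^sup>2" for x
    using nn by (simp add: power_mult_distrib)
  ultimately show ?thesis unfolding sqint_def by simp
qed

text \<open>Removing the leading term of q with a multiple of p_d, d = degree q, reduces to lower
  degree. The alternative q = 0 is stated because the zero polynomial has degree 0, which is not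
  below n when n = 0.\<close>

lemma orthonormal_poly_lower_degree:
  assumes v: "integrable cheb_measure v" and nn: "\<And>x. 0 \<le> v x"
    and deg: "\<And>n. degree (p n) = n" and lead: "\<And>n. lead_coeff (p n) > 0"
    and orth: "\<And>m n. ip cheb_measure (\<lambda>x. poly (p n) x * sqrt (v x)) (\<lambda>x. poly (p m) x * sqrt (v x)) = (if m = n then 1 else 0)"
    and q: "degree q < n \<or> q = 0"
  shows "ip cheb_measure (\<lambda>x. poly q x * sqrt (v x)) (\<lambda>x. poly (p n) x * sqrt (v x)) = 0"
  using q
proof (induction "degree q" arbitrary: q rule: less_induct)
  case less
  let ?f = "\<lambda>q x. poly q x * sqrt (v x)"
  show ?case
  proof (cases "q = 0")
    case True
    thus ?thesis by (simp add: ip_def)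
  next
    case False
    define d where "d = degree q"
    have dn: "d < n" using less False by (simp add: d_def)
    define c where "c = lead_coeff q / lead_coeff (p d)"
    define r where "r = q - smult c (p d)"
    have "coeff r d = 0" using lead[of d] deg[of d] by (simp add: r_def c_def d_def)
    moreover have "degree r \<le> d"
      unfolding r_def using deg[of d] by (intro degree_diff_le) (auto simp: d_def intro: order_trans[OF degree_smult_le])
    ultimately have "r = 0 \<or> degree r < d" by (metis leading_coeff_0_iff order_le_less)
    hence "ip cheb_measure (?f r) (?f (p n)) = 0"
    proof
      assume "degree r < d"
      thus ?thesis using dn less(1)[of r] by (simp add: d_def)
    qed (simp add: ip_def)
    moreover have "?f q = (\<lambda>x. ?f r x + c *\<^sub>R ?f (p d) x)" by (auto simp: r_def algebra_simps)
    ultimately show ?thesis using dn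
      by (simp only: ip_add_left[OF sqint_weighted_poly[OF v nn] sqint_scaleR[OF sqint_weighted_poly[OF v nn]] sqint_weighted_poly[OF v nn]]
          ip_scaleR_left orth) auto
  qed
qed

subsection \<open>Asymptotics of orthonormal polynomials\<close>

lemma sqint_inner_circ_power:
  fixes f :: "real \<Rightarrow> complex"
  assumes f: "sqint cheb_measure f"
  shows "sqint cheb_measure (\<lambda>x. circ x ^ n \<bullet> f x)"
    "ip cheb_measure (\<lambda>x. circ x ^ n \<bullet> f x) (\<lambda>x. circ x ^ n \<bullet> f x) \<le> ip cheb_measure f f"
proof -
  have [measurable]: "f \<in> borel_measurable borel" using sqint_measurable[OF f] by simp
  have le: "(norm (circ x ^ n \<bullet> f x))\<^sup>2 \<le> (norm (f x))\<^sup>2" for x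
    using Cauchy_Schwarz_ineq2[of "circ x ^ n" "f x"] by (intro power_mono) (auto simp: norm_power)
  have i: "integrable cheb_measure (\<lambda>x. (norm (f x))\<^sup>2)" using f by (simp add: sqint_def)
  show s: "sqint cheb_measure (\<lambda>x. circ x ^ n \<bullet> f x)"
    unfolding sqint_def by (intro conjI Bochner_Integration.integrable_bound[OF i]) (use le in auto)
  show "ip cheb_measure (\<lambda>x. circ x ^ n \<bullet> f x) (\<lambda>x. circ x ^ n \<bullet> f x) \<le> ip cheb_measure f f"
    unfolding ip_self using s le i by (intro integral_mono) (auto simp: sqint_def)
qed

text \<open>For a unimodular a, 2 (Re a)^2 = 1 + Re a^2. With a = U cnj(z)^n the second term is a
  coefficient of U^2 at frequency 2n and vanishes in the limit.\<close>

lemma ip_inner_circ_power_tendsto: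
  assumes [measurable]: "U \<in> borel_measurable borel" and U: "\<And>x. norm (U x) = 1"
  shows "(\<lambda>n. ip cheb_measure (\<lambda>x. sqrt 2 * (U x \<bullet> circ x ^ n)) (\<lambda>x. sqrt 2 * (U x \<bullet> circ x ^ n))) \<longlonglongrightarrow> 1"
proof -
  let ?\<mu> = cheb_measure
  have s: "sqint ?\<mu> (\<lambda>x. U x ^ 2)"
    using U by (auto intro!: sqint_AE_bounded[of _ _ 1] emeasure_cheb_measure_UNIV simp: norm_power)
  have z: "sqint ?\<mu> (\<lambda>x. circ x ^ n)" for n
    by (auto intro!: sqint_AE_bounded[of _ _ 1] emeasure_cheb_measure_UNIV simp: norm_power)
  have "(sqrt 2 * (U x \<bullet> circ x ^ n)) * (sqrt 2 * (U x \<bullet> circ x ^ n)) = 1 + U x ^ 2 \<bullet> circ x ^ (n * 2)" for x n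
  proof -
    define a where "a = U x * cnj (circ x ^ n)"
    have "norm a = 1" using U by (simp add: a_def norm_mult norm_power del: complex_cnj_power)
    hence "(Re a)\<^sup>2 + (Im a)\<^sup>2 = 1" using cmod_power2[of a] by simp
    hence "2 * (Re a)\<^sup>2 = 1 + Re (a\<^sup>2)" by (simp add: power2_eq_square)
    moreover have "a\<^sup>2 = U x ^ 2 * cnj (circ x ^ (n * 2))" by (simp add: a_def power_mult_distrib power_mult)
    moreover have "(sqrt 2 * (U x \<bullet> circ x ^ n)) * (sqrt 2 * (U x \<bullet> circ x ^ n)) = 2 * (U x \<bullet> circ x ^ n)\<^sup>2"
      by (simp add: power2_eq_square)
    ultimately show ?thesis by (simp only: Re_mult_cnj[symmetric] a_def)
  qed
  hence eq: "(sqrt 2 * (U x \<bullet> circ x ^ n)) \<bullet> (sqrt 2 * (U x \<bullet> circ x ^ n)) = 1 + U x ^ 2 \<bullet> circ x ^ (n * 2)" for x n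
    by (simp only: inner_real_def)
  have "ip ?\<mu> (\<lambda>x. sqrt 2 * (U x \<bullet> circ x ^ n)) (\<lambda>x. sqrt 2 * (U x \<bullet> circ x ^ n))
     = 1 + ip ?\<mu> (\<lambda>x. U x ^ 2) (\<lambda>x. circ x ^ (n * 2))" for n
    unfolding ip_def eq using integrable_inner_sqint[OF s z, of "n * 2"]
    by (subst Bochner_Integration.integral_add) auto
  moreover have "(\<lambda>n. 1 + ip ?\<mu> (\<lambda>x. U x ^ 2) (\<lambda>x. circ x ^ (n * 2))) \<longlonglongrightarrow> 1 + 0"
  proof (intro tendsto_intros)
    have "filterlim (\<lambda>n::nat. n * 2) at_top at_top"
      by (rule filterlim_at_top_mono[OF filterlim_ident]) simp
    from filterlim_compose[OF Riemann_Lebesgue_circ[OF s] this]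
    show "(\<lambda>n. ip ?\<mu> (\<lambda>x. U x ^ 2) (\<lambda>x. circ x ^ (n * 2))) \<longlonglongrightarrow> 0" .
  qed
  ultimately show ?thesis by simp
qed

lemma orthonormal_poly_L2_asymptotics:
  assumes v: "integrable cheb_measure v" "AE x in cheb_measure. v x > 0" and nn: "\<And>x. 0 \<le> v x"
    and lnv: "integrable cheb_measure (\<lambda>x. ln (v x))"
    and deg: "\<And>n. degree (p n) = n" and lead: "\<And>n. lead_coeff (p n) > 0"
    and orth: "\<And>m n. ip cheb_measure (\<lambda>x. poly (p n) x * sqrt (v x)) (\<lambda>x. poly (p m) x * sqrt (v x)) = (if m = n then 1 else 0)"
  obtains U where "U \<in> borel_measurable borel" "\<And>x. norm (U x) = 1"
    "(\<lambda>n. ip cheb_measure (\<lambda>x. poly (p n) x * sqrt (v x) - sqrt 2 * (U x \<bullet> circ x ^ n))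
       (\<lambda>x. poly (p n) x * sqrt (v x) - sqrt 2 * (U x \<bullet> circ x ^ n))) \<longlonglongrightarrow> 0"
proof -
  let ?\<mu> = cheb_measure
  let ?W = "\<lambda>h x. sqrt (v x) *\<^sub>R cpoly h (circ x)"
  let ?f = "\<lambda>q x. poly q x * sqrt (v x)"
  obtain u U h m where u: "sqint ?\<mu> u" and m: "m > 0"
    and Um[measurable]: "U \<in> borel_measurable borel" and U1: "\<And>x. norm (U x) = 1"
    and uU: "AE x in ?\<mu>. u x = sqrt m *\<^sub>R U x"
    and h0: "\<And>k. poly (h k) 0 = 1"
    and hu: "(\<lambda>k. ip ?\<mu> (\<lambda>x. ?W (h k) x - u x) (\<lambda>x. ?W (h k) x - u x)) \<longlonglongrightarrow> 0"
    and ug: "\<And>g. poly g 0 = 1 \<Longrightarrow> ip ?\<mu> u (?W g) = m"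
    by (rule szego_extremal_function[OF v nn lnv], rule that)
  have [measurable]: "u \<in> borel_measurable borel" using sqint_measurable[OF u] by simp
  have [measurable]: "v \<in> borel_measurable borel" using borel_measurable_integrable[OF v(1)] by simp
  have sW: "sqint ?\<mu> (?W g)" for g by (rule sqint_weighted_cpoly[OF v(1) nn])
  have sf: "sqint ?\<mu> (?f q)" for q by (rule sqint_weighted_poly[OF v(1) nn])
  define Y where "Y n x = sqrt 2 * (U x \<bullet> circ x ^ n)" for n x
  have [measurable]: "Y n \<in> borel_measurable borel" for n unfolding Y_def[abs_def] by measurable
  have Yb: "\<bar>Y n x\<bar> \<le> sqrt 2" for n x
    using Cauchy_Schwarz_ineq2[of "U x" "circ x ^ n"] U1 by (simp add: Y_def abs_mult norm_power)
  have sY: "sqint ?\<mu> (Y n)" for n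
    using Yb by (intro sqint_AE_bounded[of _ _ "sqrt 2"] emeasure_cheb_measure_UNIV) auto
  have Y1: "(\<lambda>n. ip ?\<mu> (Y n) (Y n)) \<longlonglongrightarrow> 1"
    unfolding Y_def[abs_def] by (rule ip_inner_circ_power_tendsto[OF Um U1])
  \<comment> \<open>This number has two roles: it is the value at 0 of the polynomial z^n p_n, and
    it is the ratio of the leading coefficients of p_n and of the test polynomial.\<close>
  define c where "c n = lead_coeff (p n) / 2 ^ n" for n
  have c: "c n > 0" for n using lead by (simp add: c_def)
  define d where "d n = c n * sqrt (2 * m)" for n
  have cross: "ip ?\<mu> (?f (p n)) (Y n) = d n" for n
  proof -
    obtain Q where Q: "poly Q 0 = coeff (p n) n / 2 ^ n"
      "\<And>y. norm y = 1 \<Longrightarrow> y ^ n * of_real (poly (p n) (Re y)) = cpoly Q y"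
      using poly_Re_mult_power_eq_cpoly[of "p n" n] deg[of n] by auto
    have Q0: "poly Q 0 = c n" using Q(1) deg[of n] by (simp add: c_def)
    have "poly (smult (1 / c n) Q) 0 = 1" using Q0 c[of n] by simp
    from ug[OF this] have "ip ?\<mu> u (\<lambda>x. (1 / c n) *\<^sub>R ?W Q x) = m"
      by (simp add: scaleR_conv_of_real mult.left_commute)
    hence "1 / c n * ip ?\<mu> u (?W Q) = m" by (simp only: ip_scaleR_right)
    hence uQ: "ip ?\<mu> u (?W Q) = c n * m" using c[of n] by (simp add: field_simps)
    have "ip ?\<mu> (?f (p n)) (Y n) = (\<integral>x. sqrt 2 / sqrt m * (u x \<bullet> ?W Q x) \<partial>?\<mu>)"
      unfolding ip_def
    proof (rule integral_cong_AE)
      show "AE x in ?\<mu>. ?f (p n) x \<bullet> Y n x = sqrt 2 / sqrt m * (u x \<bullet> ?W Q x)"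
        using AE_Re_circ uU
      proof eventually_elim
        case (elim x)
        have "cpoly Q (circ x) = poly (p n) x *\<^sub>R circ x ^ n"
          using Q(2)[OF norm_circ, of x] elim(1) by (simp add: scaleR_conv_of_real mult.commute)
        thus ?case using m by (simp add: elim(2) Y_def)
      qed
    qed measurable
    also have "\<dots> = sqrt 2 / sqrt m * (c n * m)" using uQ by (simp add: ip_def)
    also have "\<dots> = d n" using m by (simp add: d_def real_sqrt_mult field_simps)
    finally show ?thesis .
  qed
  \<comment> \<open>P - p_n / c_n has degree below n, so P has inner product 1 / c_n with the unit
    vector p_n. Cauchy-Schwarz bounds this by the norm of P, which is compared with that of 2
    Re(z^-n u) = sqrt(2m) Y_n.\<close>
  have upper: "1 / c n \<le> sqrt (2 * m) * sqrt (ip ?\<mu> (Y n) (Y n))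
      + 2 * sqrt (ip ?\<mu> (\<lambda>x. ?W (h k) x - u x) (\<lambda>x. ?W (h k) x - u x))" if nk: "degree (h k) < n" for n k
  proof -
    obtain P where P: "degree P \<le> n" "coeff P n = 2 ^ n * coeff (h k) 0"
      "\<And>y. norm y = 1 \<Longrightarrow> poly P (Re y) = 2 * (y ^ n \<bullet> cpoly (h k) y)"
      using inner_power_cpoly_eq_poly_Re[OF nk] by blast
    have P2: "coeff P n = 2 ^ n" using P(2) h0[of k] by (simp add: poly_0_coeff_0)
    define R where "R = P - smult (1 / c n) (p n)"
    have "coeff R n = 0" using P2 lead[of n] deg[of n] by (simp add: R_def c_def)
    moreover have "degree R \<le> n"
      unfolding R_def using P(1) deg[of n] by (intro degree_diff_le) (auto intro: order_trans[OF degree_smult_le])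
    ultimately have "degree R < n \<or> R = 0" by (metis leading_coeff_0_iff order_le_less)
    hence R0: "ip ?\<mu> (?f R) (?f (p n)) = 0"
      by (intro orthonormal_poly_lower_degree[OF v(1) nn deg lead orth])
    have "?f P = (\<lambda>x. ?f R x + (1 / c n) *\<^sub>R ?f (p n) x)" by (auto simp: R_def algebra_simps)
    hence "ip ?\<mu> (?f P) (?f (p n)) = 1 / c n"
      by (simp only: ip_add_left[OF sf sqint_scaleR[OF sf] sf] ip_scaleR_left orth R0) simp
    hence "1 / c n \<le> sqrt (ip ?\<mu> (?f P) (?f P))"
      using Cauchy_Schwarz_ip[OF sf[of P] sf[of "p n"]] orth[of n n] c[of n] by simp
    also have "ip ?\<mu> (?f P) (?f P) = ip ?\<mu>
        (\<lambda>x. sqrt (2 * m) *\<^sub>R Y n x + 2 *\<^sub>R (circ x ^ n \<bullet> (?W (h k) x - u x)))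
        (\<lambda>x. sqrt (2 * m) *\<^sub>R Y n x + 2 *\<^sub>R (circ x ^ n \<bullet> (?W (h k) x - u x)))"
    proof (rule ip_cong_AE)
      show "AE x in ?\<mu>. ?f P x = sqrt (2 * m) *\<^sub>R Y n x + 2 *\<^sub>R (circ x ^ n \<bullet> (?W (h k) x - u x))"
        using AE_Re_circ uU
      proof eventually_elim
        case (elim x)
        have "?f P x = 2 * (circ x ^ n \<bullet> ?W (h k) x)" using P(3)[OF norm_circ, of x] elim(1) by simp
        moreover have "sqrt (2 * m) * Y n x = 2 * (circ x ^ n \<bullet> u x)"
          by (simp add: elim(2) Y_def real_sqrt_mult inner_commute)
        ultimately show ?case by (simp add: inner_diff_right)
      qed
      thus "AE x in ?\<mu>. ?f P x = sqrt (2 * m) *\<^sub>R Y n x + 2 *\<^sub>R (circ x ^ n \<bullet> (?W (h k) x - u x))" .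
    qed measurable
    also have "sqrt \<dots> \<le> sqrt (ip ?\<mu> (\<lambda>x. sqrt (2 * m) *\<^sub>R Y n x) (\<lambda>x. sqrt (2 * m) *\<^sub>R Y n x))
      + sqrt (ip ?\<mu> (\<lambda>x. 2 *\<^sub>R (circ x ^ n \<bullet> (?W (h k) x - u x))) (\<lambda>x. 2 *\<^sub>R (circ x ^ n \<bullet> (?W (h k) x - u x))))"
      by (intro sqrt_ip_triangle sqint_scaleR sY sqint_inner_circ_power(1) sqint_diff sW u)
    also have "sqrt (ip ?\<mu> (\<lambda>x. sqrt (2 * m) *\<^sub>R Y n x) (\<lambda>x. sqrt (2 * m) *\<^sub>R Y n x))
        = sqrt (2 * m) * sqrt (ip ?\<mu> (Y n) (Y n))"
      unfolding sqrt_ip_scaleR using m by simp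
    also have "sqrt (ip ?\<mu> (\<lambda>x. 2 *\<^sub>R (circ x ^ n \<bullet> (?W (h k) x - u x))) (\<lambda>x. 2 *\<^sub>R (circ x ^ n \<bullet> (?W (h k) x - u x))))
       = 2 * sqrt (ip ?\<mu> (\<lambda>x. circ x ^ n \<bullet> (?W (h k) x - u x)) (\<lambda>x. circ x ^ n \<bullet> (?W (h k) x - u x)))"
      unfolding sqrt_ip_scaleR by simp
    also have "\<dots> \<le> 2 * sqrt (ip ?\<mu> (\<lambda>x. ?W (h k) x - u x) (\<lambda>x. ?W (h k) x - u x))"
      by (intro mult_left_mono real_sqrt_le_mono sqint_inner_circ_power(2) sqint_diff sW u) simp
    finally show ?thesis by simp
  qed
  have err: "ip ?\<mu> (\<lambda>x. ?f (p n) x - Y n x) (\<lambda>x. ?f (p n) x - Y n x) = 1 - 2 * d n + ip ?\<mu> (Y n) (Y n)" for n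
    using ip_self_diff[OF sf sY, of "p n" n] cross[of n] orth[of n n] by simp
  have "(\<lambda>n. 1 - 2 * d n + ip ?\<mu> (Y n) (Y n)) \<longlonglongrightarrow> 0"
  proof (rule LIMSEQ_I)
    fix e :: real assume "e > 0"
    \<comment> \<open>The final estimate is 1 - 2 d_n + |Y_n|^2 < 1 - 2 (1 - \<delta>) + (1 +
      \<delta>) = 3 \<delta>, which is below e.\<close>
    define \<delta> where "\<delta> = e / 4"
    have \<delta>: "\<delta> > 0" using \<open>e > 0\<close> by (simp add: \<delta>_def)
    have sm: "sqrt (2 * m) > 0" using m by simp
    have "(\<lambda>k. 2 * sqrt (ip ?\<mu> (\<lambda>x. ?W (h k) x - u x) (\<lambda>x. ?W (h k) x - u x)) / sqrt (2 * m)) \<longlonglongrightarrow> 2 * sqrt 0 / sqrt (2 * m)"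
      using sm by (intro tendsto_intros hu) auto
    hence "eventually (\<lambda>k. 2 * sqrt (ip ?\<mu> (\<lambda>x. ?W (h k) x - u x) (\<lambda>x. ?W (h k) x - u x)) / sqrt (2 * m) < \<delta> / 2) sequentially"
      using \<delta> by (intro order_tendstoD(2)) auto
    then obtain k where k: "2 * sqrt (ip ?\<mu> (\<lambda>x. ?W (h k) x - u x) (\<lambda>x. ?W (h k) x - u x)) / sqrt (2 * m) < \<delta> / 2"
      using eventually_happens sequentially_bot by blast
    have "(\<lambda>n. sqrt (ip ?\<mu> (Y n) (Y n))) \<longlonglongrightarrow> sqrt 1" by (intro tendsto_intros Y1)
    hence "eventually (\<lambda>n. sqrt (ip ?\<mu> (Y n) (Y n)) < 1 + \<delta> / 2) sequentially"
      using \<delta> by (intro order_tendstoD(2)) auto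
    moreover have "eventually (\<lambda>n. ip ?\<mu> (Y n) (Y n) < 1 + \<delta>) sequentially"
      using \<delta> by (intro order_tendstoD(2)[OF Y1]) auto
    moreover have "eventually (\<lambda>n. degree (h k) < n) sequentially" by (rule eventually_gt_at_top)
    ultimately have "eventually (\<lambda>n. norm (1 - 2 * d n + ip ?\<mu> (Y n) (Y n) - 0) < e) sequentially"
    proof eventually_elim
      case (elim n)
      have dn: "d n > 0" using c[of n] sm by (simp add: d_def)
      have "1 / d n = (1 / c n) / sqrt (2 * m)" by (simp add: d_def)
      also have "\<dots> \<le> (sqrt (2 * m) * sqrt (ip ?\<mu> (Y n) (Y n))
          + 2 * sqrt (ip ?\<mu> (\<lambda>x. ?W (h k) x - u x) (\<lambda>x. ?W (h k) x - u x))) / sqrt (2 * m)"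
        using upper[OF elim(3)] sm by (intro divide_right_mono) auto
      also have "\<dots> = sqrt (ip ?\<mu> (Y n) (Y n))
          + 2 * sqrt (ip ?\<mu> (\<lambda>x. ?W (h k) x - u x) (\<lambda>x. ?W (h k) x - u x)) / sqrt (2 * m)"
        using sm by (simp add: add_divide_distrib)
      also have "\<dots> < 1 + \<delta>" using elim(1) k by linarith
      finally have "1 < d n * (1 + \<delta>)" using dn by (simp add: field_simps)
      \<comment> \<open>This turns d_n > 1 / (1 + \<delta>) into d_n > 1 - \<delta>.\<close>
      moreover have "(1 - \<delta>) * (1 + \<delta>) \<le> 1" by (simp add: algebra_simps)
      ultimately have "(1 - \<delta>) * (1 + \<delta>) < d n * (1 + \<delta>)" by linarith
      hence "1 - \<delta> < d n" using \<delta> by (simp add: mult_less_cancel_right)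
      hence "1 - 2 * d n + ip ?\<mu> (Y n) (Y n) < e" using elim(2) \<delta> unfolding \<delta>_def by linarith
      moreover have "0 \<le> 1 - 2 * d n + ip ?\<mu> (Y n) (Y n)" using ip_self_nonneg err by metis
      ultimately show ?case by simp
    qed
    thus "\<exists>no. \<forall>n\<ge>no. norm (1 - 2 * d n + ip ?\<mu> (Y n) (Y n) - 0) < e" by (simp add: eventually_sequentially)
  qed
  hence "(\<lambda>n. ip ?\<mu> (\<lambda>x. ?f (p n) x - Y n x) (\<lambda>x. ?f (p n) x - Y n x)) \<longlonglongrightarrow> 0" by (simp only: err)
  from that[OF Um U1 this[unfolded Y_def]] show ?thesis by blast
qed

text \<open>The Chebyshev polynomial T_j turns U cnj(z)^n into its j-th power, so for j >= 1 the
  integral is a coefficient of U^j at frequency nj and tends to 0, the matching integral on the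
  right. Linearity and uniform approximation do the rest.\<close>

lemma integral_continuous_inner_circ_power_tendsto:
  fixes \<phi> :: "real \<Rightarrow> real"
  assumes [measurable]: "U \<in> borel_measurable borel" and U: "\<And>x. norm (U x) = 1"
    and \<phi>: "continuous_on UNIV \<phi>"
  shows "(\<lambda>n. \<integral>x. \<phi> (U x \<bullet> circ x ^ n) \<partial>cheb_measure) \<longlonglongrightarrow> (\<integral>x. \<phi> (Re (circ x)) \<partial>cheb_measure)"
proof -
  let ?\<mu> = cheb_measure
  have [measurable]: "\<phi> \<in> borel_measurable borel" by (rule borel_measurable_continuous_onI[OF \<phi>])
  have A: "U x \<bullet> circ x ^ n \<in> {-1..1}" "Re (circ x) \<in> {-1..1}" for x n
    using Cauchy_Schwarz_ineq2[of "U x" "circ x ^ n"] U abs_Re_le_cmod[of "circ x"]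
    by (auto simp: norm_power abs_le_iff)
  have int: "integrable ?\<mu> (\<lambda>x. \<psi> (a x))"
    if \<psi>: "continuous_on UNIV \<psi>" and [measurable]: "a \<in> borel_measurable borel" and a: "\<And>x. a x \<in> {-1..1}"
    for \<psi> a :: "real \<Rightarrow> real"
  proof -
    have [measurable]: "\<psi> \<in> borel_measurable borel" by (rule borel_measurable_continuous_onI[OF \<psi>])
    have "compact (\<psi> ` {-1..1})" by (intro compact_continuous_image continuous_on_subset[OF \<psi>]) auto
    then obtain B where "\<forall>t\<in>{-1..1}. \<bar>\<psi> t\<bar> \<le> B" using compact_imp_bounded by (fastforce simp: bounded_iff)
    thus ?thesis using a by (intro cheb.integrable_const_bound[of _ B]) auto
  qed
  have cp: "continuous_on UNIV (poly q)" for q :: "real poly" by (intro continuous_intros)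
  have poly: "(\<lambda>n. \<integral>x. poly q (U x \<bullet> circ x ^ n) \<partial>?\<mu>) \<longlonglongrightarrow> (\<integral>x. poly q (Re (circ x)) \<partial>?\<mu>)" for q
  proof (induction q rule: chebT_span_induct)
    case (2 j)
    have "poly (chebT j) (U x \<bullet> circ x ^ n) = U x ^ j \<bullet> circ x ^ (n * j)" for x n
    proof -
      have "norm (U x * cnj (circ x ^ n)) = 1" using U by (simp add: norm_mult norm_power del: complex_cnj_power)
      from poly_chebT_Re[OF this, of j] show ?thesis
        by (simp only: Re_mult_cnj[symmetric] power_mult_distrib power_mult complex_cnj_power)
    qed
    hence eq: "(\<integral>x. poly (chebT j) (U x \<bullet> circ x ^ n) \<partial>?\<mu>) = ip ?\<mu> (\<lambda>x. U x ^ j) (\<lambda>x. circ x ^ (n * j))" for n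
      by (simp add: ip_def)
    have eq2: "(\<integral>x. poly (chebT j) (Re (circ x)) \<partial>?\<mu>) = (if j = 0 then 1 else 0)"
      using integral_Re_circ_power[of j] by (simp add: poly_chebT_Re)
    show ?case
    proof (cases "j = 0")
      case True
      thus ?thesis by simp
    next
      case False
      have s: "sqint ?\<mu> (\<lambda>x. U x ^ j)"
        using U by (auto intro!: sqint_AE_bounded[of _ _ 1] emeasure_cheb_measure_UNIV simp: norm_power)
      have "filterlim (\<lambda>n::nat. n * j) at_top at_top"
        using False by (intro filterlim_at_top_mono[OF filterlim_ident]) simp
      from filterlim_compose[OF Riemann_Lebesgue_circ[OF s] this] show ?thesis
        unfolding eq eq2 using False by simp
    qed
  next
    case (3 p q)
    have "(\<integral>x. poly (p + q) (a x) \<partial>?\<mu>) = (\<integral>x. poly p (a x) \<partial>?\<mu>) + (\<integral>x. poly q (a x) \<partial>?\<mu>)"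
      if "a \<in> borel_measurable borel" "\<And>x. a x \<in> {-1..1}" for a
      using int[OF cp that] by simp
    from this[of "\<lambda>x. U x \<bullet> circ x ^ _"] this[of "\<lambda>x. Re (circ x)"] show ?case
      using tendsto_add[OF 3] A by simp
  next
    case (4 c p)
    thus ?case by (simp add: tendsto_mult_left)
  qed simp
  show ?thesis
  proof (rule LIMSEQ_I)
    fix e :: real assume "e > 0"
    then obtain q where q: "\<And>t. t \<in> {-1..1} \<Longrightarrow> \<bar>\<phi> t - poly q t\<bar> < e / 4"
      using Weierstrass_poly[of "-1" 1 \<phi> "e / 4", OF continuous_on_subset[OF \<phi>]] by auto
    have diff: "\<bar>(\<integral>x. \<phi> (a x) \<partial>?\<mu>) - (\<integral>x. poly q (a x) \<partial>?\<mu>)\<bar> \<le> e / 4"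
      if a: "a \<in> borel_measurable borel" "\<And>x. a x \<in> {-1..1}" for a
    proof -
      have i: "integrable ?\<mu> (\<lambda>x. \<phi> (a x) - poly q (a x))"
        using int[OF \<phi> a] int[OF cp a, of q] by simp
      have "(\<integral>x. \<phi> (a x) \<partial>?\<mu>) - (\<integral>x. poly q (a x) \<partial>?\<mu>) = (\<integral>x. \<phi> (a x) - poly q (a x) \<partial>?\<mu>)"
        using int[OF \<phi> a] int[OF cp a, of q] by simp
      also have "\<bar>\<dots>\<bar> \<le> (\<integral>x. \<bar>\<phi> (a x) - poly q (a x)\<bar> \<partial>?\<mu>)" by (rule integral_abs_bound)
      also have "\<dots> \<le> (\<integral>x. e / 4 \<partial>?\<mu>)"
        using i q[OF a(2)] by (intro integral_mono integrable_abs) (auto intro: less_imp_le)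
      finally show ?thesis by simp
    qed
    have "eventually (\<lambda>n. dist (\<integral>x. poly q (U x \<bullet> circ x ^ n) \<partial>?\<mu>) (\<integral>x. poly q (Re (circ x)) \<partial>?\<mu>) < e / 4) sequentially"
      using \<open>e > 0\<close> by (intro tendstoD[OF poly]) simp
    hence "eventually (\<lambda>n. norm ((\<integral>x. \<phi> (U x \<bullet> circ x ^ n) \<partial>?\<mu>) - (\<integral>x. \<phi> (Re (circ x)) \<partial>?\<mu>)) < e) sequentially"
    proof eventually_elim
      case (elim n)
      have "\<bar>(\<integral>x. \<phi> (U x \<bullet> circ x ^ n) \<partial>?\<mu>) - (\<integral>x. poly q (U x \<bullet> circ x ^ n) \<partial>?\<mu>)\<bar> \<le> e / 4"
        using A by (intro diff) auto
      moreover have "\<bar>(\<integral>x. \<phi> (Re (circ x)) \<partial>?\<mu>) - (\<integral>x. poly q (Re (circ x)) \<partial>?\<mu>)\<bar> \<le> e / 4"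
        using A by (intro diff) auto
      ultimately show ?case using elim \<open>e > 0\<close> unfolding dist_real_def real_norm_def by linarith
    qed
    thus "\<exists>no. \<forall>n\<ge>no. norm ((\<integral>x. \<phi> (U x \<bullet> circ x ^ n) \<partial>?\<mu>) - (\<integral>x. \<phi> (Re (circ x)) \<partial>?\<mu>)) < e"
      by (simp add: eventually_sequentially)
  qed
qed

subsection \<open>The entropy integral\<close>

text \<open>The cut is strict because \<open>Delta\<close> contains the points with |f_n| =
  M.\<close>

definition xlogx_trunc :: "real \<Rightarrow> real \<Rightarrow> real" where
  "xlogx_trunc M t = (if \<bar>t\<bar> < M then xlogx t else 0)"

lemma measurable_xlogx_trunc [measurable]: "xlogx_trunc M \<in> borel_measurable borel"
  unfolding xlogx_trunc_def[abs_def] by measurable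

lemma xlogx_trunc_bounded: "\<exists>B\<ge>0. \<forall>t. \<bar>xlogx_trunc M t\<bar> \<le> B"
proof -
  have "compact (xlogx ` {- M..M})"
    by (intro compact_continuous_image continuous_on_subset[OF continuous_xlogx]) auto
  then obtain B where "\<forall>t\<in>{- M..M}. \<bar>xlogx t\<bar> \<le> B"
    using compact_imp_bounded by (fastforce simp: bounded_iff)
  hence "\<forall>t. \<bar>xlogx_trunc M t\<bar> \<le> max B 0" by (auto simp: xlogx_trunc_def abs_less_iff intro: max.coboundedI1)
  thus ?thesis by (intro exI[of _ "max B 0"]) auto
qed

text \<open>The truncated function may jump at M and -M. Keeping \<delta> at most M - sqrt 2
  prevents s from reaching a jump when |t| <= sqrt 2, and below M uniform continuity
  applies.\<close>

lemma xlogx_trunc_close: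
  assumes M: "M > sqrt 2" and e: "e > 0"
  obtains \<delta> where "\<delta> > 0" "\<And>s t. \<bar>t\<bar> \<le> sqrt 2 \<Longrightarrow> \<bar>s - t\<bar> < \<delta> \<Longrightarrow> \<bar>xlogx_trunc M s - xlogx t\<bar> < e"
proof -
  have "uniformly_continuous_on {- M..M} xlogx"
    by (intro compact_uniformly_continuous continuous_on_subset[OF continuous_xlogx]) auto
  then obtain d where d: "d > 0" "\<And>s t. s \<in> {- M..M} \<Longrightarrow> t \<in> {- M..M} \<Longrightarrow> dist s t < d \<Longrightarrow> dist (xlogx s) (xlogx t) < e"
    unfolding uniformly_continuous_on_def using e by metis
  show ?thesis
  proof
    show "min d (M - sqrt 2) > 0" using d M by simp
    fix s t :: real assume t: "\<bar>t\<bar> \<le> sqrt 2" and st: "\<bar>s - t\<bar> < min d (M - sqrt 2)"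
    have s: "\<bar>s\<bar> < M" using t st by linarith
    moreover have "dist (xlogx s) (xlogx t) < e"
      using s t st M by (intro d(2)) (auto simp: dist_real_def)
    ultimately show "\<bar>xlogx_trunc M s - xlogx t\<bar> < e" by (simp add: xlogx_trunc_def dist_real_def)
  qed
qed

lemma integral_xlogx_trunc_tendsto:
  assumes v: "integrable cheb_measure v" "AE x in cheb_measure. v x > 0" and nn: "\<And>x. 0 \<le> v x"
    and lnv: "integrable cheb_measure (\<lambda>x. ln (v x))"
    and deg: "\<And>n. degree (p n) = n" and lead: "\<And>n. lead_coeff (p n) > 0"
    and orth: "\<And>m n. ip cheb_measure (\<lambda>x. poly (p n) x * sqrt (v x)) (\<lambda>x. poly (p m) x * sqrt (v x)) = (if m = n then 1 else 0)"
    and M: "M > sqrt 2"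
  shows "(\<lambda>n. \<integral>x. xlogx_trunc M (poly (p n) x * sqrt (v x)) \<partial>cheb_measure) \<longlonglongrightarrow> 1 - ln 2"
proof -
  let ?\<mu> = cheb_measure
  let ?f = "\<lambda>n x. poly (p n) x * sqrt (v x)"
  obtain U where [measurable]: "U \<in> borel_measurable borel" and U: "\<And>x. norm (U x) = 1"
    and lim: "(\<lambda>n. ip ?\<mu> (\<lambda>x. ?f n x - sqrt 2 * (U x \<bullet> circ x ^ n)) (\<lambda>x. ?f n x - sqrt 2 * (U x \<bullet> circ x ^ n))) \<longlonglongrightarrow> 0"
    by (rule orthonormal_poly_L2_asymptotics[OF v nn lnv deg lead orth], rule that)
  have [measurable]: "v \<in> borel_measurable borel" using borel_measurable_integrable[OF v(1)] by simp
  define Y where "Y n x = sqrt 2 * (U x \<bullet> circ x ^ n)" for n x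
  have [measurable]: "Y n \<in> borel_measurable borel" for n unfolding Y_def[abs_def] by measurable
  have Yb: "\<bar>Y n x\<bar> \<le> sqrt 2" for n x
    using Cauchy_Schwarz_ineq2[of "U x" "circ x ^ n"] U by (simp add: Y_def abs_mult norm_power)
  have sY: "sqint ?\<mu> (Y n)" for n
    using Yb by (intro sqint_AE_bounded[of _ _ "sqrt 2"] emeasure_cheb_measure_UNIV) auto
  have sd: "sqint ?\<mu> (\<lambda>x. ?f n x - Y n x)" for n
    by (intro sqint_diff sY sqint_weighted_poly[OF v(1) nn])
  have lim': "(\<lambda>n. ip ?\<mu> (\<lambda>x. ?f n x - Y n x) (\<lambda>x. ?f n x - Y n x)) \<longlonglongrightarrow> 0"
    using lim by (simp only: Y_def)
  obtain B where B: "B \<ge> 0" "\<And>t. \<bar>xlogx_trunc M t\<bar> \<le> B" using xlogx_trunc_bounded by blast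
  have BY: "\<bar>xlogx (Y n x)\<bar> \<le> B" for n x
    using B(2)[of "Y n x"] Yb[of n x] M by (simp add: xlogx_trunc_def)
  have int1: "integrable ?\<mu> (\<lambda>x. xlogx_trunc M (?f n x))" for n
    using B by (intro cheb.integrable_const_bound[of _ B]) auto
  have int2: "integrable ?\<mu> (\<lambda>x. xlogx (Y n x))" for n
    using BY by (intro cheb.integrable_const_bound[of _ B]) auto
  have "(\<lambda>n. (\<integral>x. xlogx_trunc M (?f n x) \<partial>?\<mu>) - (\<integral>x. xlogx (Y n x) \<partial>?\<mu>)) \<longlonglongrightarrow> 0"
  proof (rule LIMSEQ_I)
    fix e :: real assume e: "e > 0"
    obtain \<delta> where \<delta>: "\<delta> > 0" "\<And>s t. \<bar>t\<bar> \<le> sqrt 2 \<Longrightarrow> \<bar>s - t\<bar> < \<delta> \<Longrightarrow> \<bar>xlogx_trunc M s - xlogx t\<bar> < e / 2"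
      using xlogx_trunc_close[OF M, of "e / 2"] e by auto
    let ?D = "\<lambda>n. ip ?\<mu> (\<lambda>x. ?f n x - Y n x) (\<lambda>x. ?f n x - Y n x)"
    \<comment> \<open>A pointwise form of Chebyshev's inequality: near Y_n the difference is at most
      e/2; elsewhere it is at most 2B, and (f_n - Y_n)^2 / \<delta>^2 is at least 1.\<close>
    have pt: "\<bar>xlogx_trunc M (?f n x) - xlogx (Y n x)\<bar> \<le> e / 2 + 2 * B / \<delta>\<^sup>2 * (norm (?f n x - Y n x))\<^sup>2" for n x
    proof (cases "\<bar>?f n x - Y n x\<bar> < \<delta>")
      case True
      from \<delta>(2)[OF Yb True] have "\<bar>xlogx_trunc M (?f n x) - xlogx (Y n x)\<bar> \<le> e / 2" by simp
      moreover have "0 \<le> 2 * B / \<delta>\<^sup>2 * (norm (?f n x - Y n x))\<^sup>2" using B(1) by simp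
      ultimately show ?thesis by linarith
    next
      case False
      hence "\<delta>\<^sup>2 \<le> (norm (?f n x - Y n x))\<^sup>2" using \<delta>(1) by (intro power_mono) auto
      hence "2 * B * 1 \<le> 2 * B * ((norm (?f n x - Y n x))\<^sup>2 / \<delta>\<^sup>2)"
        using B(1) \<delta>(1) by (intro mult_left_mono) auto
      moreover have "\<bar>xlogx_trunc M (?f n x) - xlogx (Y n x)\<bar> \<le> 2 * B"
        using B(2)[of "?f n x"] BY[of n x] by linarith
      ultimately show ?thesis using e by simp
    qed
    have bd: "\<bar>(\<integral>x. xlogx_trunc M (?f n x) \<partial>?\<mu>) - (\<integral>x. xlogx (Y n x) \<partial>?\<mu>)\<bar> \<le> e / 2 + 2 * B / \<delta>\<^sup>2 * ?D n" for n
    proof -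
      have "(\<integral>x. xlogx_trunc M (?f n x) \<partial>?\<mu>) - (\<integral>x. xlogx (Y n x) \<partial>?\<mu>)
        = (\<integral>x. xlogx_trunc M (?f n x) - xlogx (Y n x) \<partial>?\<mu>)" using int1 int2 by simp
      also have "\<bar>\<dots>\<bar> \<le> (\<integral>x. \<bar>xlogx_trunc M (?f n x) - xlogx (Y n x)\<bar> \<partial>?\<mu>)" by (rule integral_abs_bound)
      also have "\<dots> \<le> (\<integral>x. e / 2 + 2 * B / \<delta>\<^sup>2 * (norm (?f n x - Y n x))\<^sup>2 \<partial>?\<mu>)"
      proof (rule integral_mono)
        show "integrable ?\<mu> (\<lambda>x. \<bar>xlogx_trunc M (?f n x) - xlogx (Y n x)\<bar>)"
          using int1[of n] int2[of n] by (intro integrable_abs Bochner_Integration.integrable_diff)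
        show "integrable ?\<mu> (\<lambda>x. e / 2 + 2 * B / \<delta>\<^sup>2 * (norm (?f n x - Y n x))\<^sup>2)"
          using sd[of n] unfolding sqint_def
          by (intro Bochner_Integration.integrable_add integrable_mult_right) auto
      qed (rule pt)
      also have "\<dots> = e / 2 + 2 * B / \<delta>\<^sup>2 * ?D n"
      proof -
        have "integrable ?\<mu> (\<lambda>x. 2 * B / \<delta>\<^sup>2 * (norm (?f n x - Y n x))\<^sup>2)"
          using sd[of n] unfolding sqint_def by (intro integrable_mult_right) auto
        thus ?thesis unfolding ip_self
          by (subst Bochner_Integration.integral_add) (simp_all only: integral_mult_right_zero, simp_all)
      qed
      finally show ?thesis .
    qed
    have "(\<lambda>n. e / 2 + 2 * B / \<delta>\<^sup>2 * ?D n) \<longlonglongrightarrow> e / 2 + 2 * B / \<delta>\<^sup>2 * 0" by (intro tendsto_intros lim')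
    from order_tendstoD(2)[OF this, of e]
    have "eventually (\<lambda>n. e / 2 + 2 * B / \<delta>\<^sup>2 * ?D n < e) sequentially"
      using e by simp
    hence "eventually (\<lambda>n. norm ((\<integral>x. xlogx_trunc M (?f n x) \<partial>?\<mu>) - (\<integral>x. xlogx (Y n x) \<partial>?\<mu>) - 0) < e) sequentially"
      by eventually_elim (use bd in \<open>auto intro: le_less_trans\<close>)
    thus "\<exists>no. \<forall>n\<ge>no. norm ((\<integral>x. xlogx_trunc M (?f n x) \<partial>?\<mu>) - (\<integral>x. xlogx (Y n x) \<partial>?\<mu>) - 0) < e"
      by (simp only: eventually_sequentially)
  qed
  moreover have "(\<lambda>n. \<integral>x. xlogx (Y n x) \<partial>?\<mu>) \<longlonglongrightarrow> 1 - ln 2"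
  proof -
    have "continuous_on UNIV (\<lambda>t. xlogx (sqrt 2 * t))"
      by (rule continuous_on_compose2[OF continuous_xlogx]) (auto intro!: continuous_intros)
    from integral_continuous_inner_circ_power_tendsto[OF _ U this] show ?thesis
      by (simp add: Y_def integral_xlogx_sqrt2)
  qed
  ultimately have "(\<lambda>n. (\<integral>x. xlogx_trunc M (?f n x) \<partial>?\<mu>) - (\<integral>x. xlogx (Y n x) \<partial>?\<mu>) + (\<integral>x. xlogx (Y n x) \<partial>?\<mu>)) \<longlonglongrightarrow> 0 + (1 - ln 2)"
    by (rule tendsto_add)
  thus ?thesis by simp
qed

text \<open>All of the negative part comes from B, where g is integrable, so no difference of
  infinities arises even if the integral over A is infinite.\<close>

lemma ext_set_integral_split:
  fixes g :: "real \<Rightarrow> real"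
  assumes [measurable]: "A \<in> sets borel" "B \<in> sets borel" "A \<inter> B = {}"
    and [measurable]: "(\<lambda>x. g x * indicator (A \<union> B) x) \<in> borel_measurable borel"
    and nn: "\<And>x. x \<in> A \<Longrightarrow> 0 \<le> g x"
    and B: "integrable lborel (\<lambda>x. g x * indicator B x)"
  shows "ext_set_integral (A \<union> B) g = ext_set_integral A g + ereal (\<integral>x. g x * indicator B x \<partial>lborel)"
proof -
  let ?gA = "\<lambda>x. g x * indicator A x" and ?gB = "\<lambda>x. g x * indicator B x"
  have "(\<lambda>x. (g x * indicator (A \<union> B) x) * indicator A x) \<in> borel_measurable borel" by measurable
  also have "(\<lambda>x. (g x * indicator (A \<union> B) x) * indicator A x) = ?gA" by (auto simp: fun_eq_iff split: split_indicator)
  finally have [measurable]: "?gA \<in> borel_measurable borel" .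
  have [measurable]: "?gB \<in> borel_measurable borel" using borel_measurable_integrable[OF B] by simp
  have pos: "(\<integral>\<^sup>+ x. ennreal (g x * indicator (A \<union> B) x) \<partial>lborel) = (\<integral>\<^sup>+ x. ennreal (?gA x) \<partial>lborel) + (\<integral>\<^sup>+ x. ennreal (?gB x) \<partial>lborel)"
    using assms(3) by (subst nn_integral_add[symmetric]) (auto intro!: nn_integral_cong split: split_indicator)
  have neg: "(\<integral>\<^sup>+ x. ennreal (- (g x * indicator (A \<union> B) x)) \<partial>lborel) = (\<integral>\<^sup>+ x. ennreal (- ?gB x) \<partial>lborel)"
    using nn assms(3) by (intro nn_integral_cong) (auto simp: ennreal_neg split: split_indicator)
  have negA: "(\<integral>\<^sup>+ x. ennreal (- ?gA x) \<partial>lborel) = 0"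
  proof -
    have "(\<integral>\<^sup>+ x. ennreal (- ?gA x) \<partial>lborel) = (\<integral>\<^sup>+ x. 0 \<partial>(lborel :: real measure))"
      using nn by (intro nn_integral_cong) (auto simp: ennreal_neg split: split_indicator)
    thus ?thesis by simp
  qed
  obtain a b where ab: "a \<ge> 0" "b \<ge> 0" "(\<integral>\<^sup>+ x. ennreal (?gB x) \<partial>lborel) = ennreal a"
    "(\<integral>\<^sup>+ x. ennreal (- ?gB x) \<partial>lborel) = ennreal b" "(\<integral>x. ?gB x \<partial>lborel) = a - b"
    using B by (rule integrableE)
  obtain c where c: "enn2ereal (\<integral>\<^sup>+ x. ennreal (?gA x) \<partial>lborel) = c" "c \<ge> 0" by simp
  show ?thesis
    unfolding ext_set_integral_def pos neg negA ab plus_ennreal.rep_eq c(1)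
    using c(2) ab(1,2) by (cases c) (simp_all add: enn2ereal_ennreal zero_ennreal.rep_eq)
qed

theorem theorem2:
  fixes w :: "real \<Rightarrow> real" and p :: "nat \<Rightarrow> real poly"
  assumes w_int: "set_integrable lborel {-1..1} w"
    and w_nonneg: "\<forall>x\<in>{-1..1}. w x \<ge> 0"
    and w_norm: "(LINT x:{-1..1}|lborel. w x) = 1"
    and w0_pos: "AE x in lborel. x \<in> {-1..1} \<longrightarrow> wzero w x > 0"
    and logw0_int: "set_integrable lborel {-1..1} (\<lambda>x. ln (wzero w x) * cheb_rho x)"
    and orth: "orthonormal_polys w p"
  shows "\<forall>M > sqrt 2. \<exists>r :: nat \<Rightarrow> real. r \<longlonglongrightarrow> 0 \<and>
           (\<forall>n. entropyF w (p n) =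
                  ereal (ln 2 - 1)
                  - ext_set_integral (Delta w (p n) M)
                      (\<lambda>x. ln ((ffn w (p n) x)\<^sup>2) * (ffn w (p n) x)\<^sup>2 * cheb_rho x)
                  + ereal (r n))"
proof (intro allI impI)
  fix M :: real assume M: "M > sqrt 2"
  let ?\<mu> = cheb_measure and ?I = "{-1..1::real}"
  let ?ind = "indicator {-1..1::real} :: real \<Rightarrow> real"
  \<comment> \<open>The assumptions on w concern only the interval; the indicator makes v measurable
    and nonnegative on the whole line.\<close>
  define v where "v x = ?ind x * wzero w x" for x
  have [measurable]: "(\<lambda>x. ?ind x * w x) \<in> borel_measurable borel"
    using borel_measurable_integrable[OF w_int[unfolded set_integrable_def]] by simp
  have v_alt: "v = (\<lambda>x. pi * sqrt (1 - x\<^sup>2) * (?ind x * w x))" by (auto simp: v_def wzero_def fun_eq_iff)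
  have [measurable]: "v \<in> borel_measurable borel" unfolding v_alt by measurable
  have sq1: "x\<^sup>2 \<le> 1" if "x \<in> ?I" for x using that by (auto simp: abs_square_le_1 abs_le_iff)
  have vnn: "0 \<le> v x" for x
    using w_nonneg sq1[of x] by (auto simp: v_alt split: split_indicator)
  have ends: "AE x in lborel. x \<noteq> (1::real) \<and> x \<noteq> -1"
    using AE_lborel_singleton[of "1::real"] AE_lborel_singleton[of "-1::real"] by eventually_elim simp
  \<comment> \<open>At the endpoints the left side is 0 while w is arbitrary, so the transfer
    between w(x) dx and the weight v under the arcsine law holds up to two points.\<close>
  have interior: "cheb_rho x * wzero w x = w x" if "x \<in> ?I" "x \<noteq> 1 \<and> x \<noteq> -1" for x
  proof -
    have "sqrt (1 - x\<^sup>2) \<noteq> 0" using that by (auto simp: power2_eq_1_iff)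
    thus ?thesis by (simp add: cheb_rho_def wzero_def)
  qed
  have rv: "AE x in lborel. ?ind x * cheb_rho x * (G x * v x) = ?ind x * (G x * w x)" for G
    using ends by eventually_elim (use interior in \<open>auto simp: v_def split: split_indicator\<close>)
  have v_int: "integrable ?\<mu> v"
  proof -
    have "integrable lborel (\<lambda>x. ?ind x * cheb_rho x * v x) \<longleftrightarrow> integrable lborel (\<lambda>x. ?ind x * w x)"
      using rv[of "\<lambda>_. 1"] by (intro integrable_cong_AE) auto
    thus ?thesis using w_int by (simp add: integral_cheb_measure(2) set_integrable_def)
  qed
  have v_pos: "AE x in ?\<mu>. v x > 0"
    unfolding cheb_measure_def
  proof (subst AE_density)
    show "AE x in lborel. 0 < ennreal (?ind x * cheb_rho x) \<longrightarrow> v x > 0"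
      using w0_pos by eventually_elim (auto simp: v_def split: split_indicator)
  qed simp
  have lnv: "integrable ?\<mu> (\<lambda>x. ln (v x))"
  proof -
    have "(\<lambda>x. ?ind x * cheb_rho x * ln (v x)) = (\<lambda>x. ?ind x *\<^sub>R (ln (wzero w x) * cheb_rho x))"
      by (auto simp: v_def fun_eq_iff split: split_indicator)
    thus ?thesis using logw0_int by (simp add: integral_cheb_measure(2) set_integrable_def)
  qed
  have deg: "degree (p n) = n" and lead: "lead_coeff (p n) > 0" for n
    using orth unfolding orthonormal_polys_def by blast+
  define f where "f n x = poly (p n) x * sqrt (v x)" for n x
  have [measurable]: "f n \<in> borel_measurable borel" for n unfolding f_def[abs_def] by measurable
  have ipf: "ip ?\<mu> (\<lambda>x. poly (p n) x * sqrt (v x)) (\<lambda>x. poly (p m) x * sqrt (v x)) = (if m = n then 1 else 0)" for m n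
  proof -
    have eq: "(poly (p n) x * sqrt (v x)) \<bullet> (poly (p m) x * sqrt (v x)) = (poly (p n) x * poly (p m) x) * v x" for x
      using vnn[of x] by (simp add: mult.assoc mult.left_commute)
    have "ip ?\<mu> (\<lambda>x. poly (p n) x * sqrt (v x)) (\<lambda>x. poly (p m) x * sqrt (v x)) =
       (\<integral>x. ?ind x * cheb_rho x * ((poly (p n) x * poly (p m) x) * v x) \<partial>lborel)"
      unfolding ip_def eq by (subst integral_cheb_measure(1)) auto
    also have "\<dots> = (\<integral>x. (poly (p n) x * poly (p m) x) * (?ind x * w x) \<partial>lborel)"
    proof (rule integral_cong_AE)
      show "AE x in lborel. ?ind x * cheb_rho x * ((poly (p n) x * poly (p m) x) * v x)
          = (poly (p n) x * poly (p m) x) * (?ind x * w x)"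
        using rv[of "\<lambda>x. poly (p n) x * poly (p m) x"] by eventually_elim (simp add: mult.left_commute)
    qed auto
    also have "\<dots> = (LINT x:?I|lborel. poly (p n) x * poly (p m) x * w x)"
      unfolding set_lebesgue_integral_def by (intro Bochner_Integration.integral_cong) auto
    also have "\<dots> = (if m = n then 1 else 0)" using orth by (auto simp: orthonormal_polys_def)
    finally show ?thesis .
  qed
  have lim: "(\<lambda>n. \<integral>x. xlogx_trunc M (f n x) \<partial>?\<mu>) \<longlonglongrightarrow> 1 - ln 2"
    unfolding f_def by (rule integral_xlogx_trunc_tendsto[OF v_int v_pos vnn lnv deg lead ipf M])
  define r where "r n = (1 - ln 2) - (\<integral>x. xlogx_trunc M (f n x) \<partial>?\<mu>)" for n
  have "r \<longlonglongrightarrow> (1 - ln 2) - (1 - ln 2)" unfolding r_def[abs_def] by (intro tendsto_intros lim)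
  hence r0: "r \<longlonglongrightarrow> 0" by simp
  have "entropyF w (p n) = ereal (ln 2 - 1)
      - ext_set_integral (Delta w (p n) M) (\<lambda>x. ln ((ffn w (p n) x)\<^sup>2) * (ffn w (p n) x)\<^sup>2 * cheb_rho x)
      + ereal (r n)" for n
  proof -
    define A where "A = {x \<in> ?I. M \<le> \<bar>f n x\<bar>}"
    define B where "B = {x \<in> ?I. \<bar>f n x\<bar> < M}"
    define g where "g x = xlogx (f n x) * cheb_rho x" for x
    have AB: "A \<in> sets borel" "B \<in> sets borel" "A \<inter> B = {}" "A \<union> B = ?I"
      by (auto simp: A_def B_def)
    have ffn: "ffn w (p n) x = f n x" if "x \<in> ?I" for x using that by (simp add: ffn_def f_def v_def)
    have DA: "Delta w (p n) M = A" using ffn by (auto simp: Delta_def A_def)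
    have [measurable]: "g \<in> borel_measurable borel" unfolding g_def[abs_def] by measurable
    \<comment> \<open>On A the value |f_n| is at least M > 1, so the logarithm is
      nonnegative.\<close>
    have gnn: "0 \<le> g x" if "x \<in> A" for x
    proof -
      have "0 < M" by (rule less_trans[OF _ M]) simp
      have "1 \<le> M\<^sup>2" using M power_mono[of "sqrt 2" M 2] by simp
      also from \<open>0 < M\<close> have "M\<^sup>2 \<le> \<bar>f n x\<bar>\<^sup>2" using that by (intro power_mono) (auto simp: A_def)
      finally have "0 \<le> ln ((f n x)\<^sup>2)" by simp
      thus ?thesis using that cheb_rho_nonneg[of x] by (simp add: g_def xlogx_def A_def)
    qed
    obtain C where C: "\<And>t. \<bar>xlogx_trunc M t\<bar> \<le> C" using xlogx_trunc_bounded by blast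
    have "integrable ?\<mu> (\<lambda>x. xlogx_trunc M (f n x))"
      using C by (intro cheb.integrable_const_bound[of _ C]) auto
    moreover have gB: "(\<lambda>x. ?ind x * cheb_rho x * xlogx_trunc M (f n x)) = (\<lambda>x. g x * indicator B x)"
      by (auto simp: fun_eq_iff g_def B_def xlogx_trunc_def split: split_indicator)
    ultimately have iB: "integrable lborel (\<lambda>x. g x * indicator B x)"
      by (simp add: integral_cheb_measure(2))
    have "(\<integral>x. g x * indicator B x \<partial>lborel) = (\<integral>x. xlogx_trunc M (f n x) \<partial>?\<mu>)"
      by (subst integral_cheb_measure(1)) (auto simp: gB)
    with ext_set_integral_split[OF AB(1-3) _ gnn iB]
    have split: "ext_set_integral ?I g = ext_set_integral A g + ereal (1 - ln 2 - r n)"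
      by (simp add: AB(4) r_def)
    have "ext_set_integral (Delta w (p n) M) (\<lambda>x. ln ((ffn w (p n) x)\<^sup>2) * (ffn w (p n) x)\<^sup>2 * cheb_rho x)
      = ext_set_integral A g"
    proof -
      have "ln ((ffn w (p n) x)\<^sup>2) * (ffn w (p n) x)\<^sup>2 * cheb_rho x * indicator A x = g x * indicator A x" for x
        using ffn[of x] by (auto simp: g_def xlogx_def A_def split: split_indicator)
      thus ?thesis by (simp only: DA ext_set_integral_def)
    qed
    moreover have "entropyF w (p n) = - ext_set_integral ?I g"
    proof -
      have "AE x in lborel. ln ((poly (p n) x)\<^sup>2 * wzero w x) * (poly (p n) x)\<^sup>2 * w x * ?ind x = g x * ?ind x"
        using ends
      proof eventually_elim
        case (elim x)
        show ?case
        proof (cases "x \<in> ?I")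
          case True
          have f2: "(f n x)\<^sup>2 = (poly (p n) x)\<^sup>2 * wzero w x"
            using True vnn[of x] by (simp add: f_def v_def power_mult_distrib)
          show ?thesis using interior[OF True elim] True
            by (simp add: g_def xlogx_def f2 mult_ac)
        qed simp
      qed
      hence "(\<integral>\<^sup>+ x. ennreal (ln ((poly (p n) x)\<^sup>2 * wzero w x) * (poly (p n) x)\<^sup>2 * w x * ?ind x) \<partial>lborel)
           = (\<integral>\<^sup>+ x. ennreal (g x * ?ind x) \<partial>lborel)"
        "(\<integral>\<^sup>+ x. ennreal (- (ln ((poly (p n) x)\<^sup>2 * wzero w x) * (poly (p n) x)\<^sup>2 * w x * ?ind x)) \<partial>lborel)
           = (\<integral>\<^sup>+ x. ennreal (- (g x * ?ind x)) \<partial>lborel)"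
        by (auto intro!: nn_integral_cong_AE)
      thus ?thesis unfolding entropyF_def ext_set_integral_def by simp
    qed
    \<comment> \<open>If the integral over A is plus infinity, both sides are minus infinity; in the
      finite case this is real arithmetic.\<close>
    ultimately show ?thesis
      unfolding split by (cases "ext_set_integral A g") simp_all
  qed
  thus "\<exists>r. r \<longlonglongrightarrow> 0 \<and> (\<forall>n. entropyF w (p n) = ereal (ln 2 - 1)
      - ext_set_integral (Delta w (p n) M) (\<lambda>x. ln ((ffn w (p n) x)\<^sup>2) * (ffn w (p n) x)\<^sup>2 * cheb_rho x)
      + ereal (r n))"
    using r0 by blast
qed

end
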